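(* Let $d$ be a non-zero square-free integer and let $E^d:y^2=x^3-11d^2x+14d^3$. Then \begin{itemize} \item $\mathbb{Q}(E^d[2])=\mathbb{Q}(\sqrt2)$; \item $\mathbb{Q}(E^d[4])=\mathbb{Q}(\alpha,\sqrt d)$, where $f_4(\alpha)=0$ with $f_4(x)=x^8-4x^6+8x^4-4x^2+1$; \item $\mathbb{Q}(E^d[8])=\mathbb{Q}(\beta,\sqrt d)$, where $f_8(\beta)=0$ with $f_8(x)=x^{32}+16x^{31}+120x^{30}+560x^{29}+1848x^{28}+4784x^{27}+11000x^{26}+25344x^{25}+59844x^{24}+133856x^{23}+260768x^{22}+419392x^{21}+534920x^{20}+513536x^{19}+332032x^{18}+93856x^{17}-43548x^{16}-22112x^{15}+61056x^{14}+77728x^{13}+20768x^{12}-18304x^{11}+320x^{10}+21440x^{9}+8240x^{8}-8256x^{7}-1888x^{6}+3584x^{5}+800x^{4}-1216x^{3}+320x^{2}+8.$ \end{itemize} In particular, $[\mathbb{Q}(E^d[2]):\mathbb{Q}]=2$; if $d\in\{\pm1,\pm2\}$ then $[\mathbb{Q}(E^d[4]):\mathbb{Q}]=8$ and $[\mathbb{Q}(E^d[8]):\mathbb{Q}]=32$; otherwise $[\mathbb{Q}(E^d[4]):\mathbb{Q}]=16$ and $[\mathbb{Q}(E^d[8]):\mathbb{Q}]=64$.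
   Context: $\mathbb{Q}(E[n])$ is the field generated over $\mathbb{Q}$ by the coordinates of the $n$-torsion points of $E(\overline{\mathbb{Q}})$. *)

theory Defs
  imports
    Complex_Main
    "HOL-Computational_Algebra.Computational_Algebra"
    "HOL-Algebra.Algebra"
    "HOL-Algebra.Algebraic_Closure_Type"
begin

text \<open>
  All fields are subfields of the complex numbers, viewed as a ring record so that field
  generation and dimension are the notions of \<^theory>\<open>HOL-Algebra.Generated_Fields\<close> and
  \<^theory>\<open>HOL-Algebra.Embedded_Algebras\<close>.  In characteristic zero a generated subfield
  always contains the rationals, so \<open>rat_adjoin S\<close> is the field generated by \<open>S\<close> over
  the rationals.
\<close>

abbreviation complex_ring :: "complex ring" where
  "complex_ring \<equiv> ring_of_type_algebra"

abbreviation rat_adjoin :: "complex set \<Rightarrow> complex set" where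
  "rat_adjoin S \<equiv> generate_field complex_ring S"

text \<open>
  \<open>ring.dimension\<close> is a relation: the following says that \<open>K\<close> is a rational vector space
  of finite dimension, equal to \<open>n\<close>.
\<close>

abbreviation degree_over_rat :: "complex set \<Rightarrow> nat \<Rightarrow> bool" where
  "degree_over_rat K n \<equiv> ring.dimension complex_ring n \<rat> K"

definition algebraic_numbers :: "complex set" where
  "algebraic_numbers = {z. algebraic z}"

text \<open>Points and chord-tangent addition on a Weierstrass curve \<open>y\<^sup>2 = x\<^sup>3 + a x + b\<close>.\<close>

datatype 'a ec_point = Infty | Affine 'a 'a

definition ec_points :: "'a::field \<Rightarrow> 'a \<Rightarrow> 'a set \<Rightarrow> 'a ec_point set" where
  "ec_points a b K =
     insert Infty {Affine x y | x y. x \<in> K \<and> y \<in> K \<and> y ^ 2 = x ^ 3 + a * x + b}"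

fun ec_add :: "'a::field \<Rightarrow> 'a ec_point \<Rightarrow> 'a ec_point \<Rightarrow> 'a ec_point" where
  "ec_add a Infty Q = Q"
| "ec_add a (Affine x1 y1) Infty = Affine x1 y1"
| "ec_add a (Affine x1 y1) (Affine x2 y2) =
     (if x1 = x2 \<and> y1 = - y2 then Infty
      else
        let m = (if x1 = x2 then (3 * x1 ^ 2 + a) / (2 * y1) else (y2 - y1) / (x2 - x1));
            x3 = m ^ 2 - x1 - x2
        in Affine x3 (m * (x1 - x3) - y1))"

definition ec_mult :: "'a::field \<Rightarrow> nat \<Rightarrow> 'a ec_point \<Rightarrow> 'a ec_point" where
  "ec_mult a n P = (ec_add a P ^^ n) Infty"

definition ec_torsion :: "'a::field \<Rightarrow> 'a \<Rightarrow> 'a set \<Rightarrow> nat \<Rightarrow> 'a ec_point set" where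
  "ec_torsion a b K n = {P \<in> ec_points a b K. ec_mult a n P = Infty}"

fun ec_coords :: "'a ec_point \<Rightarrow> 'a set" where
  "ec_coords Infty = {}"
| "ec_coords (Affine x y) = {x, y}"

definition torsion_field :: "complex \<Rightarrow> complex \<Rightarrow> nat \<Rightarrow> complex set" where
  "torsion_field a b n = rat_adjoin (\<Union>P \<in> ec_torsion a b algebraic_numbers n. ec_coords P)"

definition E_a :: "int \<Rightarrow> complex" where
  "E_a d = - 11 * of_int d ^ 2"

definition E_b :: "int \<Rightarrow> complex" where
  "E_b d = 14 * of_int d ^ 3"

lemma E_nonsingular:
  assumes "d \<noteq> 0"
  shows "4 * E_a d ^ 3 + 27 * E_b d ^ 2 \<noteq> 0"
proof -
  have "4 * E_a d ^ 3 + 27 * E_b d ^ 2 = - 32 * of_int d ^ 6"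
    by (simp add: E_a_def E_b_def power_mult_distrib flip: power_mult)
  then show ?thesis
    using assms by simp
qed

definition f4 :: "complex \<Rightarrow> complex" where
  "f4 x = x^8 - 4*x^6 + 8*x^4 - 4*x^2 + 1"

definition f8 :: "complex \<Rightarrow> complex" where
  "f8 x = x^32 + 16*x^31 + 120*x^30 + 560*x^29 + 1848*x^28 + 4784*x^27 + 11000*x^26
     + 25344*x^25 + 59844*x^24 + 133856*x^23 + 260768*x^22 + 419392*x^21 + 534920*x^20
     + 513536*x^19 + 332032*x^18 + 93856*x^17 - 43548*x^16 - 22112*x^15 + 61056*x^14
     + 77728*x^13 + 20768*x^12 - 18304*x^11 + 320*x^10 + 21440*x^9 + 8240*x^8 - 8256*x^7
     - 1888*x^6 + 3584*x^5 + 800*x^4 - 1216*x^3 + 320*x^2 + 8"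

end

theory Submission
  imports Defs
begin

text \<open>
  The curve \<open>E : y\<^sup>2 = x\<^sup>3 - 11 x + 14\<close> has the roots \<open>2\<close> and \<open>- 1 \<plusminus> 2 \<surd>2\<close>, and \<open>(x, y) \<mapsto> (d x, d \<surd>d y)\<close>
  maps it isomorphically to its twist \<open>E\<^sup>d\<close>.  The image of the point \<open>(1, 2)\<close> of order four
  shows that \<open>\<surd>d\<close> lies in the fields of the 4-torsion and of the 8-torsion of \<open>E\<^sup>d\<close>, so each of them is
  the corresponding field of \<open>E\<close> with \<open>\<surd>d\<close> adjoined (\<open>torsion_field_twist\<close>).

  The torsion fields of \<open>E\<close> are computed by halving points.  A point \<open>(x0, y0)\<close> of a curve with
  roots \<open>e1\<close>, \<open>e2\<close>, \<open>e3\<close> has the halves \<open>x = x0 + g1 g2 + g1 g3 + g2 g3\<close> where \<open>gi\<^sup>2 = x0 - ei\<close>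
  (\<open>half_point_double\<close>, \<open>double_imp_half_point\<close>), so halving adjoins exactly these square roots.
  Starting from the roots one obtains \<open>\<rat>(E[4]) = \<rat>(\<i>, 2\<^sup>1\<^sup>/\<^sup>4)\<close> and
  \<open>\<rat>(E[8]) = \<rat>(\<i>, 2\<^sup>1\<^sup>/\<^sup>8, u)\<close> with \<open>u\<^sup>2 = 1 + \<surd>2\<close>.  To know that multiplication by \<open>8\<close>, defined as
  iterated addition of a point, is threefold doubling, only the instance
  \<open>P + (P + Q) = (P + P) + Q\<close> of associativity is needed (\<open>ec_add_double_left\<close>).

  The degrees follow by climbing the tower \<open>\<rat> \<subset> \<rat>(\<surd>2) \<subset> \<rat>(2\<^sup>1\<^sup>/\<^sup>4) \<subset> \<rat>(2\<^sup>1\<^sup>/\<^sup>8) \<subset> \<rat>(2\<^sup>1\<^sup>/\<^sup>8, u)\<close> of real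
  fields, then adjoining \<open>\<i>\<close> and finally \<open>\<surd>d\<close>.  Apart from the last step for \<open>d = \<plusminus> 1, \<plusminus> 2\<close>, each
  is a proper quadratic extension: if a square root \<open>x\<close> of an element of \<open>F\<close> lies in \<open>F(b)\<close> with \<open>b\<^sup>2 \<in> F\<close>, then \<open>x\<close> or \<open>b x\<close> lies in \<open>F\<close>
  (\<open>sqrt_descent\<close>), and the norm of a square is a square (\<open>sqrt_norm\<close>), which contradicts the
  positivity of squares in a real field or the irrationality of \<open>\<surd>2\<close>.  The same argument shows
  that the only square-free \<open>d\<close> with \<open>\<surd>d\<close> in the field of the 8-torsion of \<open>E\<close> are \<open>\<plusminus> 1\<close> and \<open>\<plusminus> 2\<close>.

  Finally, a root of \<open>f4\<close> or \<open>f8\<close> is a polynomial expression in some choice of \<open>\<i>\<close>, \<open>2\<^sup>1\<^sup>/\<^sup>4\<close>, or of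
  \<open>\<i>\<close>, \<open>2\<^sup>1\<^sup>/\<^sup>8\<close>, \<open>u\<close>.  These generators are recovered from the root by factoring the
  polynomial over one quadratic extension after the other: a factorisation
  \<open>p\<^sup>2 - b\<^sup>2 q\<^sup>2 = (p - b q) (p + b q)\<close> with coprime \<open>p\<close> and \<open>q\<close> expresses \<open>b\<close>, up to sign, as
  the quotient of \<open>p\<close> and \<open>q\<close> at the root.  For \<open>f8\<close> this reaches \<open>2\<^sup>1\<^sup>/\<^sup>4\<close>, and completing the
  square in the remaining quartic factor gives the last two square roots (\<open>f4_root_field\<close>, \<open>f8_root_field\<close>).
\<close>

section \<open>Repeated addition on a Weierstrass curve\<close>

lemma ec_points_Infty [simp]: "Infty \<in> ec_points a b UNIV"
  by (simp add: ec_points_def)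

lemma ec_points_Affine [simp]:
  "Affine x y \<in> ec_points a b UNIV \<longleftrightarrow> y\<^sup>2 = x ^ 3 + a * x + b"
  by (auto simp: ec_points_def)

lemma ec_add_Infty_right [simp]: "ec_add a P Infty = P"
  by (cases P) auto

text \<open>
  The slope \<open>m\<close> of the chord or tangent satisfies two equations, of which the first determines it
  when \<open>x1 \<noteq> x2\<close>, and the second when the two points coincide.  This treats both cases alike.
\<close>

lemma ec_add_slopeI:
  fixes a :: "'a::field_char_0"
  assumes "y2 = y1 + m * (x2 - x1)" and "m * (y1 + y2) = x1\<^sup>2 + x1 * x2 + x2\<^sup>2 + a"
    and "x1 \<noteq> x2 \<or> y1 + y2 \<noteq> 0"
  shows "ec_add a (Affine x1 y1) (Affine x2 y2) =
    Affine (m\<^sup>2 - x1 - x2) (m * (x1 - (m\<^sup>2 - x1 - x2)) - y1)"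
proof (cases "x1 = x2")
  case True
  then have y: "y2 = y1" "y1 \<noteq> 0" using assms by auto
  then have "m = (3 * x1\<^sup>2 + a) / (2 * y1)"
    using assms(2) True by (simp add: field_simps power2_eq_square)
  then show ?thesis using True y by (simp add: Let_def)
next
  case False
  then have "m = (y2 - y1) / (x2 - x1)" using assms(1) by (simp add: field_simps)
  then show ?thesis using False by (simp add: Let_def)
qed

lemma ec_add_slopeE:
  fixes a :: "'a::field_char_0"
  assumes "Affine x1 y1 \<in> ec_points a b UNIV" "Affine x2 y2 \<in> ec_points a b UNIV"
    and "x1 \<noteq> x2 \<or> y1 + y2 \<noteq> 0"
  obtains m where "y2 = y1 + m * (x2 - x1)"
    and "m * (y1 + y2) = x1\<^sup>2 + x1 * x2 + x2\<^sup>2 + a"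
proof (cases "x1 = x2")
  case True
  then have "y1\<^sup>2 = y2\<^sup>2" and n: "y1 + y2 \<noteq> 0" using assms by auto
  then have y: "y2 = y1" by (auto simp: power2_eq_iff)
  with n have "y1 \<noteq> 0" by auto
  then show thesis
    using that[of "(3 * x1\<^sup>2 + a) / (2 * y1)"] True y by (simp add: field_simps power2_eq_square)
next
  case False
  define m where "m = (y2 - y1) / (x2 - x1)"
  have 1: "y2 = y1 + m * (x2 - x1)" using False by (simp add: m_def)
  have "y1\<^sup>2 = x1 ^ 3 + a * x1 + b" "y2\<^sup>2 = x2 ^ 3 + a * x2 + b" using assms by auto
  then have "(y2 - y1) * (y1 + y2) = (x2 - x1) * (x1\<^sup>2 + x1 * x2 + x2\<^sup>2 + a)"
    by (simp add: algebra_simps power2_eq_square power3_eq_cube)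
  then have "(x2 - x1) * (m * (y1 + y2)) = (x2 - x1) * (x1\<^sup>2 + x1 * x2 + x2\<^sup>2 + a)"
    using 1 by (simp add: mult_ac)
  with False 1 show thesis using that[of m] by auto
qed

lemma ec_add_closed:
  fixes a :: "'a::field_char_0"
  assumes "P \<in> ec_points a b UNIV" "Q \<in> ec_points a b UNIV"
  shows "ec_add a P Q \<in> ec_points a b UNIV"
proof (cases P; cases Q)
  fix x1 y1 x2 y2
  assume PQ: "P = Affine x1 y1" "Q = Affine x2 y2"
  show ?thesis
  proof (cases "x1 \<noteq> x2 \<or> y1 + y2 \<noteq> 0")
    case True
    obtain m where m: "y2 = y1 + m * (x2 - x1)" "m * (y1 + y2) = x1\<^sup>2 + x1 * x2 + x2\<^sup>2 + a"
      using ec_add_slopeE True assms PQ by blast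
    have a: "a = m * (y1 + y2) - (x1\<^sup>2 + x1 * x2 + x2\<^sup>2)" using m(2) by simp
    have b: "b = y1\<^sup>2 - x1 ^ 3 - a * x1" using assms PQ by simp
    have "(m * (x1 - (m\<^sup>2 - x1 - x2)) - y1)\<^sup>2 =
        (m\<^sup>2 - x1 - x2) ^ 3 + a * (m\<^sup>2 - x1 - x2) + b"
      unfolding b a m(1) by (simp add: algebra_simps power2_eq_square power3_eq_cube)
    then show ?thesis unfolding PQ ec_add_slopeI[OF m True] ec_points_Affine .
  next
    case False
    then show ?thesis using PQ by (simp add: add_eq_0_iff2)
  qed
qed (use assms in auto)

lemma ec_add_commute:
  fixes a :: "'a::field_char_0"
  assumes "P \<in> ec_points a b UNIV" "Q \<in> ec_points a b UNIV"
  shows "ec_add a P Q = ec_add a Q P"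
proof (cases P; cases Q)
  fix x1 y1 x2 y2
  assume PQ: "P = Affine x1 y1" "Q = Affine x2 y2"
  show ?thesis
  proof (cases "x1 \<noteq> x2 \<or> y1 + y2 \<noteq> 0")
    case True
    obtain m where m: "y2 = y1 + m * (x2 - x1)" "m * (y1 + y2) = x1\<^sup>2 + x1 * x2 + x2\<^sup>2 + a"
      using ec_add_slopeE True assms PQ by blast
    have m1: "y1 = y2 + m * (x1 - x2)" using m(1) by (simp add: algebra_simps)
    have m2: "m * (y2 + y1) = x2\<^sup>2 + x2 * x1 + x1\<^sup>2 + a"
      using m(2) by (simp add: add_ac mult_ac)
    have n: "x2 \<noteq> x1 \<or> y2 + y1 \<noteq> 0" using True by (auto simp: add.commute)
    have x: "m\<^sup>2 - x1 - x2 = m\<^sup>2 - x2 - x1" by simp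
    have "m * (x1 - (m\<^sup>2 - x2 - x1)) - y1 = m * (x2 - (m\<^sup>2 - x2 - x1)) - y2"
      unfolding m(1) by (simp add: algebra_simps)
    then show ?thesis
      unfolding PQ ec_add_slopeI[OF m True] ec_add_slopeI[OF m1 m2 n] x by simp
  next
    case False
    then have "x2 = x1" "y2 = - y1" by (auto simp: add_eq_0_iff)
    then show ?thesis using PQ by simp
  qed
qed auto

text \<open>
  The instance of associativity that turns iterated addition into doubling.  With slopes \<open>l\<close> (tangent at \<open>P\<close>) and
  \<open>m\<close> (chord through \<open>P\<close> and \<open>Q\<close>), and \<open>v = (x2 - x1) / (l - m)\<close>, the chord through \<open>P\<close> and
  \<open>P + Q\<close> has slope \<open>- m - v\<close>, and the one through \<open>2P\<close> and \<open>Q\<close> has slope \<open>- l - v\<close>.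
\<close>

lemma ec_add_double_left:
  fixes a :: "'a::field_char_0"
  assumes P: "P \<in> ec_points a b UNIV" and Q: "Q \<in> ec_points a b UNIV"
    and ns: "4 * a ^ 3 + 27 * b\<^sup>2 \<noteq> 0"
  shows "ec_add a P (ec_add a P Q) = ec_add a (ec_add a P P) Q"
proof (cases P; cases Q)
  fix x1 y1 x2 y2
  assume PQ: "P = Affine x1 y1" "Q = Affine x2 y2"
  have c1: "y1\<^sup>2 = x1 ^ 3 + a * x1 + b" and c2: "y2\<^sup>2 = x2 ^ 3 + a * x2 + b"
    using P Q PQ by auto
  have on: "Affine x1 y1 \<in> ec_points a b UNIV" "Affine x2 y2 \<in> ec_points a b UNIV"
    using P Q PQ by auto
  have eq_cases: "y2 = y1 \<or> y2 = - y1" if "x1 = x2"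
    using c1 c2 that by (metis power2_eq_iff)
  consider "y1 = 0" "x1 = x2" | "y1 = 0" "x1 \<noteq> x2" | "y1 \<noteq> 0" "Q = P"
    | "y1 \<noteq> 0" "Q = Affine x1 (- y1)" | "y1 \<noteq> 0" "x1 \<noteq> x2"
    using eq_cases PQ by blast
  then show ?thesis
  proof cases
    case 1
    then show ?thesis using PQ eq_cases by auto
  next
    case 2
    obtain m where m: "y2 = y1 + m * (x2 - x1)" "m * (y1 + y2) = x1\<^sup>2 + x1 * x2 + x2\<^sup>2 + a"
      using ec_add_slopeE[OF on] 2 by blast
    define x3 y3 where "x3 = m\<^sup>2 - x1 - x2" and "y3 = m * (x1 - x3) - y1"
    have s: "ec_add a P Q = Affine x3 y3"
      using ec_add_slopeI[OF m] 2 PQ by (simp add: x3_def y3_def)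
    have a: "a = m * (y1 + y2) - (x1\<^sup>2 + x1 * x2 + x2\<^sup>2)" using m(2) by simp
    have "3 * x1\<^sup>2 + a \<noteq> 0"
    proof
      assume "3 * x1\<^sup>2 + a = 0"
      then have "a = - 3 * x1\<^sup>2" by (simp add: add_eq_0_iff)
      moreover from this have "b = 2 * x1 ^ 3"
        using c1 2(1) by (simp add: algebra_simps power2_eq_square power3_eq_cube)
      ultimately have "4 * a ^ 3 + 27 * b\<^sup>2 = 0"
        by (simp add: power_mult_distrib flip: power_mult)
      with ns show False by simp
    qed
    moreover have "(x2 - x1) * (x3 - x1) = 3 * x1\<^sup>2 + a"
      unfolding a x3_def m(1) 2(1) by (simp add: algebra_simps power2_eq_square)
    ultimately have "x3 \<noteq> x1" by auto
    have e1: "y3 = y1 + (- m) * (x3 - x1)" using 2(1) by (simp add: y3_def algebra_simps)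
    have e2: "(- m) * (y1 + y3) = x1\<^sup>2 + x1 * x3 + x3\<^sup>2 + a"
      unfolding a x3_def y3_def m(1) 2(1) by (simp add: algebra_simps power2_eq_square)
    have "ec_add a P (ec_add a P Q) = Affine x2 y2"
      unfolding s unfolding PQ(1) ec_add_slopeI[OF e1 e2 disjI1[OF \<open>x3 \<noteq> x1\<close>[symmetric]]]
      using m(1) 2(1) by (simp add: x3_def algebra_simps)
    then show ?thesis using 2 PQ by simp
  next
    case 3
    then show ?thesis using ec_add_commute[OF P ec_add_closed[OF P P]] by simp
  next
    case 4
    obtain l where l: "y1 = y1 + l * (x1 - x1)" "l * (y1 + y1) = x1\<^sup>2 + x1 * x1 + x1\<^sup>2 + a"
      using ec_add_slopeE[OF on(1) on(1)] 4 by auto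
    define xd yd where "xd = l\<^sup>2 - x1 - x1" and "yd = l * (x1 - xd) - y1"
    have s: "ec_add a P P = Affine xd yd"
      using ec_add_slopeI[OF l] 4 PQ by (simp add: xd_def yd_def)
    have n: "xd \<noteq> x1 \<or> yd + - y1 \<noteq> 0"
      using 4(1) by (auto simp: yd_def)
    have e1: "- y1 = yd + (- l) * (x1 - xd)" by (simp add: yd_def algebra_simps)
    \<comment> \<open>the plain name \<open>algebra\<close> denotes the ring normaliser for structures with carriers\<close>
    have e2: "(- l) * (yd + - y1) = xd\<^sup>2 + xd * x1 + x1\<^sup>2 + a"
      using l(2) unfolding xd_def yd_def by Groebner_Basis.algebra
    have "ec_add a (ec_add a P P) Q = Affine x1 y1"
      unfolding s 4(2) using ec_add_slopeI[OF e1 e2 n]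
      by (simp add: xd_def yd_def algebra_simps)
    then show ?thesis using 4 PQ by simp
  next
    case 5
    obtain l where l: "y1 = y1 + l * (x1 - x1)" "l * (y1 + y1) = x1\<^sup>2 + x1 * x1 + x1\<^sup>2 + a"
      using ec_add_slopeE[OF on(1) on(1)] 5 by auto
    obtain m where m: "y2 = y1 + m * (x2 - x1)" "m * (y1 + y2) = x1\<^sup>2 + x1 * x2 + x2\<^sup>2 + a"
      using ec_add_slopeE[OF on] 5 by blast
    define xd yd where "xd = l\<^sup>2 - x1 - x1" and "yd = l * (x1 - xd) - y1"
    define x3 y3 where "x3 = m\<^sup>2 - x1 - x2" and "y3 = m * (x1 - x3) - y1"
    have sd: "ec_add a P P = Affine xd yd"
      using ec_add_slopeI[OF l] 5 PQ by (simp add: xd_def yd_def)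
    have s3: "ec_add a P Q = Affine x3 y3"
      using ec_add_slopeI[OF m] 5 PQ by (simp add: x3_def y3_def)
    have prod: "(x2 - x1) * (x3 - x1) = 2 * y1 * (l - m)"
      using l(2) m unfolding x3_def by Groebner_Basis.algebra
    show ?thesis
    proof (cases "l = m")
      \<comment> \<open>\<open>P + Q = - P\<close>, and both sides are the point at infinity\<close>
      case True
      then have x3: "x3 = x1" using prod 5 by auto
      then have "y3 = - y1" by (simp add: y3_def)
      moreover have "xd = x2" using x3 True by (simp add: x3_def xd_def algebra_simps)
      moreover from this have "yd = - y2" using m True by (simp add: yd_def algebra_simps)
      ultimately show ?thesis unfolding s3 sd unfolding PQ using x3 by simp
    next
      case False
      define v where "v = (x2 - x1) / (l - m)"
      have v: "v * (l - m) = x2 - x1" using False by (simp add: v_def)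
      have "(l - m) * (v * (x3 - x1)) = (l - m) * (2 * y1)"
        using prod v by Groebner_Basis.algebra
      with False have v3: "v * (x3 - x1) = 2 * y1" by simp
      then have n3: "x1 \<noteq> x3" using 5 by auto
      have e1: "y3 = y1 + (- m - v) * (x3 - x1)"
        using v3 by (simp add: y3_def algebra_simps)
      have e2: "(- m - v) * (y1 + y3) = x1\<^sup>2 + x1 * x3 + x3\<^sup>2 + a"
        using v v3 m l(2) unfolding x3_def y3_def by Groebner_Basis.algebra
      have f1: "y2 = yd + (- l - v) * (x2 - xd)"
        using v v3 m l(2) unfolding xd_def yd_def x3_def by Groebner_Basis.algebra
      have f2: "(- l - v) * (yd + y2) = xd\<^sup>2 + xd * x2 + x2\<^sup>2 + a"
        using v v3 m l(2) unfolding xd_def yd_def x3_def by Groebner_Basis.algebra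
      have n: "xd \<noteq> x2 \<or> yd + y2 \<noteq> 0"
      proof (rule ccontr)
        assume "\<not> ?thesis"
        then have "xd = x2" "yd + y2 = 0" by auto
        then have "(l - m) * (x2 - x1) = 0" using m(1) unfolding yd_def by (simp add: algebra_simps)
        with False 5 show False by simp
      qed
      have "(- m - v)\<^sup>2 - x1 - x3 = (- l - v)\<^sup>2 - xd - x2"
        using v unfolding x3_def xd_def by Groebner_Basis.algebra
      moreover have "(- m - v) * (x1 - ((- m - v)\<^sup>2 - x1 - x3)) - y1 =
          (- l - v) * (xd - ((- l - v)\<^sup>2 - xd - x2)) - yd"
        using v v3 unfolding x3_def xd_def yd_def by Groebner_Basis.algebra
      ultimately show ?thesis
        unfolding s3 sd unfolding PQ
        using ec_add_slopeI[OF e1 e2] n3 ec_add_slopeI[OF f1 f2 n] by simp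
    qed
  qed
qed auto

lemma ec_mult_closed:
  fixes a :: "'a::field_char_0"
  assumes "P \<in> ec_points a b UNIV"
  shows "ec_mult a n P \<in> ec_points a b UNIV"
  by (induction n) (use assms in \<open>auto simp: ec_mult_def ec_add_closed\<close>)

lemma ec_mult_double:
  fixes a :: "'a::field_char_0"
  assumes P: "P \<in> ec_points a b UNIV" and ns: "4 * a ^ 3 + 27 * b\<^sup>2 \<noteq> 0"
  shows "ec_mult a (2 * n) P = ec_mult a n (ec_add a P P)"
proof (induction n)
  case (Suc n)
  have "ec_mult a (2 * Suc n) P = ec_add a P (ec_add a P (ec_mult a (2 * n) P))"
    by (simp add: ec_mult_def)
  also have "\<dots> = ec_add a (ec_add a P P) (ec_mult a (2 * n) P)"
    by (rule ec_add_double_left[OF P ec_mult_closed[OF P] ns])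
  also have "\<dots> = ec_mult a (Suc n) (ec_add a P P)"
    unfolding Suc by (simp add: ec_mult_def)
  finally show ?case .
qed (simp add: ec_mult_def)

section \<open>Halving points\<close>

text \<open>
  On \<open>y\<^sup>2 = (x - e1) (x - e2) (x - e3)\<close> the halves of \<open>(x0, y0)\<close> are parametrised by the
  square roots \<open>gi\<close> of \<open>x0 - ei\<close> with \<open>g1 g2 g3 = y0\<close>; the roots \<open>ei\<close> enter only through them.
\<close>

definition half_point :: "'a::field \<Rightarrow> 'a \<Rightarrow> 'a \<Rightarrow> 'a \<Rightarrow> 'a ec_point" where
  "half_point x0 g1 g2 g3 =
     Affine (x0 + g1 * g2 + g1 * g3 + g2 * g3) ((g1 + g2) * (g1 + g3) * (g2 + g3))"

text \<open>A curve \<open>y\<^sup>2 = x\<^sup>3 + a x + b\<close> whose three roots lie in the ground field.\<close>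

locale split_curve =
  fixes a b e1 e2 e3 :: "'a::field_char_0"
  assumes sum0: "e1 + e2 + e3 = 0"
    and a_eq: "a = e1 * e2 + e1 * e3 + e2 * e3"
    and b_eq: "b = - (e1 * e2 * e3)"
    and distinct: "e1 \<noteq> e2" "e1 \<noteq> e3" "e2 \<noteq> e3"
begin

lemma cubic_eq: "x ^ 3 + a * x + b = (x - e1) * (x - e2) * (x - e3)"
proof -
  have "(x - e1) * (x - e2) * (x - e3) = x ^ 3 - (e1 + e2 + e3) * x\<^sup>2 + a * x + b"
    unfolding a_eq b_eq by (simp add: algebra_simps power2_eq_square power3_eq_cube)
  then show ?thesis using sum0 by simp
qed

lemma half_point_double:
  assumes g: "g1\<^sup>2 = x0 - e1" "g2\<^sup>2 = x0 - e2" "g3\<^sup>2 = x0 - e3"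
  shows "half_point x0 g1 g2 g3 \<in> ec_points a b UNIV"
    and "ec_add a (half_point x0 g1 g2 g3) (half_point x0 g1 g2 g3) = Affine x0 (g1 * g2 * g3)"
proof -
  define x y where "x = x0 + g1 * g2 + g1 * g3 + g2 * g3"
    and "y = (g1 + g2) * (g1 + g3) * (g2 + g3)"
  have P: "half_point x0 g1 g2 g3 = Affine x y"
    by (simp add: half_point_def x_def y_def)
  have e: "e1 = x0 - g1\<^sup>2" "e2 = x0 - g2\<^sup>2" "e3 = x0 - g3\<^sup>2" using g by auto
  have f: "x - e1 = (g1 + g2) * (g1 + g3)" "x - e2 = (g1 + g2) * (g2 + g3)"
      "x - e3 = (g1 + g3) * (g2 + g3)"
    unfolding x_def e by (simp_all add: algebra_simps power2_eq_square)
  have "y\<^sup>2 = x ^ 3 + a * x + b"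
    unfolding cubic_eq f y_def by (simp add: power2_eq_square mult_ac)
  then show on: "half_point x0 g1 g2 g3 \<in> ec_points a b UNIV" using P by simp
  have "g1 + g2 \<noteq> 0" "g1 + g3 \<noteq> 0" "g2 + g3 \<noteq> 0"
    using g distinct by (auto simp: add_eq_0_iff2)
  then have y: "y + y \<noteq> 0" by (simp add: y_def)
  define m where "m = g1 + g2 + g3"
  have x0: "3 * x0 = g1\<^sup>2 + g2\<^sup>2 + g3\<^sup>2" using sum0 by (simp only: e) (simp add: algebra_simps)
  have "(x - e2) * (x - e3) + (x - e1) * (x - e3) + (x - e1) * (x - e2) =
      3 * x\<^sup>2 - 2 * (e1 + e2 + e3) * x + a"
    unfolding a_eq by (simp add: algebra_simps power2_eq_square)
  also have "\<dots> = x\<^sup>2 + x * x + x\<^sup>2 + a" using sum0 by (simp add: power2_eq_square)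
  finally have "m * (y + y) = x\<^sup>2 + x * x + x\<^sup>2 + a"
    unfolding f by (simp add: m_def y_def algebra_simps)
  then have "ec_add a (Affine x y) (Affine x y) =
      Affine (m\<^sup>2 - x - x) (m * (x - (m\<^sup>2 - x - x)) - y)"
    using ec_add_slopeI[of y y m x x a] y by simp
  moreover have x0': "m\<^sup>2 - x - x = x0"
    using x0 unfolding m_def x_def by (simp add: algebra_simps power2_eq_square)
  moreover have "m * (x - x0) - y = g1 * g2 * g3"
    unfolding m_def x_def y_def by (simp add: algebra_simps)
  ultimately show "ec_add a (half_point x0 g1 g2 g3) (half_point x0 g1 g2 g3) =
      Affine x0 (g1 * g2 * g3)"
    unfolding P by simp
qed

text \<open>
  The roots are \<open>gi = (hj + hk - hi) / 2\<close> with \<open>hi = y / (x - ei)\<close>: the tangent at \<open>(x, y)\<close>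
  has slope \<open>(h1 + h2 + h3) / 2\<close>.
\<close>

lemma double_imp_half_point:
  assumes P: "Affine x y \<in> ec_points a b UNIV"
    and D: "ec_add a (Affine x y) (Affine x y) = Affine x0 y0"
  obtains g1 g2 g3 where "g1\<^sup>2 = x0 - e1" "g2\<^sup>2 = x0 - e2" "g3\<^sup>2 = x0 - e3"
    and "Affine x y = half_point x0 g1 g2 g3" and "g1 * g2 * g3 = y0"
    and "g2 + g3 = y / (x - e1)" "g1 + g3 = y / (x - e2)" "g1 + g2 = y / (x - e3)"
proof -
  have y: "y \<noteq> 0" using D by auto
  have c: "y\<^sup>2 = (x - e1) * (x - e2) * (x - e3)" using P cubic_eq by simp
  then have n: "x - e1 \<noteq> 0" "x - e2 \<noteq> 0" "x - e3 \<noteq> 0" using y by auto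
  define h1 h2 h3 where h: "h1 = y / (x - e1)" "h2 = y / (x - e2)" "h3 = y / (x - e3)"
  define g1 g2 g3 where g: "g1 = (h2 + h3 - h1) / 2" "g2 = (h1 + h3 - h2) / 2"
    "g3 = (h1 + h2 - h3) / 2"
  have s: "g2 + g3 = h1" "g1 + g3 = h2" "g1 + g2 = h3" unfolding g by (simp_all add: field_simps)
  have k: "(x - e1) * h1 = y" "(x - e2) * h2 = y" "(x - e3) * h3 = y"
    using n unfolding h by simp_all
  have "((x - e1) * (x - e2)) * (h1 * h2) = ((x - e1) * (x - e2)) * (x - e3)"
    using arg_cong2[OF k(1) k(2), of times] c by (simp add: power2_eq_square mult_ac)
  moreover have "((x - e1) * (x - e3)) * (h1 * h3) = ((x - e1) * (x - e3)) * (x - e2)"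
    using arg_cong2[OF k(1) k(3), of times] c by (simp add: power2_eq_square mult_ac)
  moreover have "((x - e2) * (x - e3)) * (h2 * h3) = ((x - e2) * (x - e3)) * (x - e1)"
    using arg_cong2[OF k(2) k(3), of times] c by (simp add: power2_eq_square mult_ac)
  ultimately have hh: "h1 * h2 = x - e3" "h1 * h3 = x - e2" "h2 * h3 = x - e1"
    using n by simp_all
  have hhh: "h1 * h2 * h3 = y"
    using n unfolding hh by (simp add: h)
  define m where "m = g1 + g2 + g3"
  have m2: "2 * m = h1 + h2 + h3" unfolding m_def s[symmetric] by simp
  have sumh: "h1 * h2 + h1 * h3 + h2 * h3 = 3 * x"
    unfolding hh using sum0 by (simp add: algebra_simps)
  have "(x - e2) * (x - e3) + (x - e1) * (x - e3) + (x - e1) * (x - e2) =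
      3 * x\<^sup>2 - 2 * (e1 + e2 + e3) * x + a"
    unfolding a_eq by (simp add: algebra_simps power2_eq_square)
  also have "\<dots> = x\<^sup>2 + x * x + x\<^sup>2 + a" using sum0 by (simp add: power2_eq_square)
  finally have "x\<^sup>2 + x * x + x\<^sup>2 + a =
      (h1 * h3) * (h1 * h2) + (h2 * h3) * (h1 * h2) + (h2 * h3) * (h1 * h3)"
    unfolding hh by simp
  also have "\<dots> = (h1 + h2 + h3) * (h1 * h2 * h3)" by (simp add: algebra_simps)
  also have "\<dots> = m * (y + y)" unfolding hhh m2[symmetric] by simp
  finally have "ec_add a (Affine x y) (Affine x y) =
      Affine (m\<^sup>2 - x - x) (m * (x - (m\<^sup>2 - x - x)) - y)"
    using ec_add_slopeI[of y y m x x a] y by simp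
  with D have x0: "x0 = m\<^sup>2 - x - x" and y0: "y0 = m * (x - x0) - y" by auto
  have hg: "h1 * h2 = (g2 + g3) * (g1 + g3)" "h1 * h3 = (g2 + g3) * (g1 + g2)"
    "h2 * h3 = (g1 + g3) * (g1 + g2)" using s by simp_all
  have xx: "x = x0 + g1 * g2 + g1 * g3 + g2 * g3"
  proof -
    have "x = 3 * x - (m\<^sup>2 - x0)" using x0 by simp
    also have "\<dots> = x0 + g1 * g2 + g1 * g3 + g2 * g3"
      unfolding sumh[symmetric] m_def hg by (simp add: algebra_simps power2_eq_square)
    finally show ?thesis .
  qed
  have "g1\<^sup>2 = x0 - e1" "g2\<^sup>2 = x0 - e2" "g3\<^sup>2 = x0 - e3"
    using hh xx unfolding hg by (simp_all add: algebra_simps power2_eq_square)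
  moreover have yy: "y = (g1 + g2) * (g1 + g3) * (g2 + g3)" unfolding s using hhh by (simp add: mult_ac)
  moreover have "Affine x y = half_point x0 g1 g2 g3"
    unfolding half_point_def using xx yy by simp
  moreover have "g1 * g2 * g3 = y0"
  proof -
    have "x - x0 = g1 * g2 + g1 * g3 + g2 * g3" using xx by simp
    then show ?thesis unfolding y0 m_def yy by (simp add: algebra_simps)
  qed
  ultimately show thesis using that[of g1 g2 g3] s h by simp
qed

lemma double_eq_Infty_iff:
  assumes "P \<in> ec_points a b UNIV"
  shows "ec_add a P P = Infty \<longleftrightarrow> P \<in> {Infty, Affine e1 0, Affine e2 0, Affine e3 0}"
proof (cases P)
  case (Affine x y)
  have "ec_add a P P = Infty \<longleftrightarrow> y = 0" using Affine by (auto simp: Let_def)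
  also have "\<dots> \<longleftrightarrow> y = 0 \<and> (x = e1 \<or> x = e2 \<or> x = e3)"
    using assms Affine cubic_eq[of x] by auto
  finally show ?thesis using Affine by auto
qed auto

lemma two_torsion_on_curve:
  "Affine e1 0 \<in> ec_points a b UNIV" "Affine e2 0 \<in> ec_points a b UNIV"
  "Affine e3 0 \<in> ec_points a b UNIV"
  by (simp_all add: cubic_eq)

end

section \<open>Subfields of the complex numbers\<close>

lemma complex_ring_simps [simp]:
  "carrier complex_ring = UNIV" "x \<otimes>\<^bsub>complex_ring\<^esub> y = x * y"
  "x \<oplus>\<^bsub>complex_ring\<^esub> y = x + y" "\<one>\<^bsub>complex_ring\<^esub> = 1" "\<zero>\<^bsub>complex_ring\<^esub> = 0"
  by (simp_all add: ring_of_type_algebra_def)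

lemma complex_field: "field complex_ring"
  by (rule field_from_type_algebra)

interpretation C: cring complex_ring
  by (rule cring_from_type_algebra)

lemma complex_ring_a_inv [simp]: "\<ominus>\<^bsub>complex_ring\<^esub> x = - x"
  using C.minus_equality[of "- x" x] by simp

lemma complex_ring_m_inv [simp]: "x \<noteq> 0 \<Longrightarrow> inv\<^bsub>complex_ring\<^esub> x = inverse x"
  using C.comm_inv_char[of x "inverse x"] by simp

lemma complex_ring_pow [simp]: "x [^]\<^bsub>complex_ring\<^esub> (n::nat) = x ^ n"
  by (induction n) (simp_all add: mult.commute)

text \<open>An intermediate field is always given as \<open>rat_adjoin S\<close>.\<close>

lemma rat_adjoin_subfield: "subfield (rat_adjoin S) complex_ring"
  by (rule field.generate_field_is_subfield[OF complex_field]) simp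

lemma rat_adjoin_one [simp]: "1 \<in> rat_adjoin S"
  using generate_field.one[of complex_ring S] by simp

lemma rat_adjoin_incl: "x \<in> S \<Longrightarrow> x \<in> rat_adjoin S"
  by (rule generate_field.incl)

lemma rat_adjoin_uminus: "x \<in> rat_adjoin S \<Longrightarrow> - x \<in> rat_adjoin S"
  using generate_field.a_inv[of x complex_ring S] by simp

lemma rat_adjoin_add: "x \<in> rat_adjoin S \<Longrightarrow> y \<in> rat_adjoin S \<Longrightarrow> x + y \<in> rat_adjoin S"
  using generate_field.eng_add[of x complex_ring S y] by simp

lemma rat_adjoin_mult: "x \<in> rat_adjoin S \<Longrightarrow> y \<in> rat_adjoin S \<Longrightarrow> x * y \<in> rat_adjoin S"
  using generate_field.eng_mult[of x complex_ring S y] by simp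

lemma rat_adjoin_zero [simp]: "0 \<in> rat_adjoin S"
  using field.zero_in_generate[OF complex_field] by simp

lemma rat_adjoin_inverse: "x \<in> rat_adjoin S \<Longrightarrow> inverse x \<in> rat_adjoin S"
  using generate_field.m_inv[of x complex_ring S] by (cases "x = 0") auto

lemma rat_adjoin_diff: "x \<in> rat_adjoin S \<Longrightarrow> y \<in> rat_adjoin S \<Longrightarrow> x - y \<in> rat_adjoin S"
  using rat_adjoin_add[OF _ rat_adjoin_uminus, of x S y] by simp

lemma rat_adjoin_divide: "x \<in> rat_adjoin S \<Longrightarrow> y \<in> rat_adjoin S \<Longrightarrow> x / y \<in> rat_adjoin S"
  unfolding divide_inverse by (intro rat_adjoin_mult rat_adjoin_inverse)

lemma rat_adjoin_power: "x \<in> rat_adjoin S \<Longrightarrow> x ^ n \<in> rat_adjoin S"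
  by (induction n) (auto intro: rat_adjoin_mult)

lemma rat_adjoin_of_nat: "of_nat n \<in> rat_adjoin S"
  by (induction n) (auto intro: rat_adjoin_add)

lemma rat_adjoin_numeral [simp]: "numeral n \<in> rat_adjoin S"
  using rat_adjoin_of_nat[of "numeral n"] by simp

lemma rat_adjoin_of_int: "of_int n \<in> rat_adjoin S"
  by (cases n rule: int_cases2) (auto intro: rat_adjoin_of_nat rat_adjoin_uminus)

lemmas rat_adjoin_closed = rat_adjoin_uminus rat_adjoin_add rat_adjoin_mult rat_adjoin_diff
  rat_adjoin_divide rat_adjoin_power rat_adjoin_of_int rat_adjoin_one rat_adjoin_zero
  rat_adjoin_numeral

lemma Rats_subset_rat_adjoin: "\<rat> \<subseteq> rat_adjoin S"
  by (auto elim!: Rats_cases' intro!: rat_adjoin_closed)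

lemma rat_adjoin_least:
  assumes "S \<subseteq> rat_adjoin T"
  shows "rat_adjoin S \<subseteq> rat_adjoin T"
  by (rule field.generate_field_min_subfield1[OF complex_field _ rat_adjoin_subfield assms]) simp

lemma rat_adjoin_mono: "S \<subseteq> T \<Longrightarrow> rat_adjoin S \<subseteq> rat_adjoin T"
  by (intro rat_adjoin_least) (auto intro: rat_adjoin_incl)

lemma rat_adjoin_eqI:
  assumes "S \<subseteq> rat_adjoin T" and "T \<subseteq> rat_adjoin S"
  shows "rat_adjoin S = rat_adjoin T"
  using assms by (intro equalityI rat_adjoin_least)

lemma subfield_complexI:
  assumes "1 \<in> K" and "\<And>x y. x \<in> K \<Longrightarrow> y \<in> K \<Longrightarrow> x + y \<in> K"
    and "\<And>x y. x \<in> K \<Longrightarrow> y \<in> K \<Longrightarrow> x * y \<in> K" and "\<And>x. x \<in> K \<Longrightarrow> - x \<in> K"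
    and "\<And>x. x \<in> K \<Longrightarrow> x \<noteq> 0 \<Longrightarrow> inverse x \<in> K"
  shows "subfield K complex_ring"
  by (rule field.subfieldI'[OF complex_field]) (auto intro!: C.subringI assms)

lemma rat_adjoin_empty: "rat_adjoin {} = \<rat>"
proof
  have "subfield \<rat> complex_ring" by (rule subfield_complexI) auto
  then show "rat_adjoin {} \<subseteq> \<rat>" by (intro field.generate_field_min_subfield1[OF complex_field]) auto
qed (rule Rats_subset_rat_adjoin)

lemma rat_adjoin_Reals: "S \<subseteq> \<real> \<Longrightarrow> rat_adjoin S \<subseteq> \<real>"
  by (intro field.generate_field_min_subfield1[OF complex_field] subfield_complexI) auto

lemma rat_adjoin_insert_absorb:
  "b \<in> rat_adjoin S \<Longrightarrow> rat_adjoin (insert b S) = rat_adjoin S"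
  by (intro rat_adjoin_eqI) (auto intro: rat_adjoin_incl)

subsection \<open>Quadratic extensions\<close>

lemma rat_adjoin_insert_sqrt:
  assumes b: "b\<^sup>2 \<in> rat_adjoin S"
  shows "rat_adjoin (insert b S) = {p + q * b | p q. p \<in> rat_adjoin S \<and> q \<in> rat_adjoin S}"
    (is "_ = ?E")
proof (cases "b \<in> rat_adjoin S")
  case True
  have "?E = rat_adjoin S"
  proof
    show "?E \<subseteq> rat_adjoin S" using True by (auto intro: rat_adjoin_closed)
    show "rat_adjoin S \<subseteq> ?E"
      by (rule subsetI, rule CollectI, intro exI[of _ 0] exI) auto
  qed
  with rat_adjoin_insert_absorb[OF True] show ?thesis by simp
next
  case False
  let ?F = "rat_adjoin S"
  show ?thesis
  proof
    have mem: "p + q * b \<in> ?E" if "p \<in> ?F" "q \<in> ?F" for p q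
      using that by blast
    have "subfield ?E complex_ring"
    proof (rule subfield_complexI)
      show "1 \<in> ?E" using mem[of 1 0] by simp
    next
      fix x y assume "x \<in> ?E" "y \<in> ?E"
      then obtain p q p' q' where pq: "x = p + q * b" "y = p' + q' * b"
        and F: "p \<in> ?F" "q \<in> ?F" "p' \<in> ?F" "q' \<in> ?F" by blast
      have "x + y = (p + p') + (q + q') * b" unfolding pq by (simp add: algebra_simps)
      then show "x + y \<in> ?E" using mem F by (simp only:) (intro mem rat_adjoin_add F)
      have "x * y = (p * p' + q * q' * b\<^sup>2) + (p * q' + q * p') * b"
        unfolding pq by (simp add: algebra_simps power2_eq_square)
      then show "x * y \<in> ?E" by (simp only:) (intro mem rat_adjoin_add rat_adjoin_mult F b)
    next
      fix x assume "x \<in> ?E"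
      then obtain p q where pq: "x = p + q * b" and F: "p \<in> ?F" "q \<in> ?F" by blast
      have "- x = - p + (- q) * b" using pq by simp
      then show "- x \<in> ?E" by (simp only:) (intro mem rat_adjoin_uminus F)
      assume x: "x \<noteq> 0"
      let ?n = "p\<^sup>2 - q\<^sup>2 * b\<^sup>2"
      have n0: "p - q * b \<noteq> 0"
      proof
        assume z: "p - q * b = 0"
        show False
        proof (cases "q = 0")
          case True
          then show False using z x pq by simp
        next
          case q: False
          then have "b = p / q" using z by (simp add: field_simps)
          with F False show False by (auto intro: rat_adjoin_divide)
        qed
      qed
      have n: "?n = x * (p - q * b)"
        unfolding pq by (simp add: algebra_simps power2_eq_square)
      have "inverse x = (p - q * b) / ?n"
        unfolding n using x n0 by (simp add: field_simps)
      also have "\<dots> = p / ?n + (- q / ?n) * b" by (simp add: diff_divide_distrib)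
      finally show "inverse x \<in> ?E"
        by (simp only:) (intro mem rat_adjoin_closed F b)
    qed
    moreover have "insert b S \<subseteq> ?E"
    proof
      fix x assume "x \<in> insert b S"
      then consider "x = b" | "x \<in> ?F" by (auto intro: rat_adjoin_incl)
      then show "x \<in> ?E"
      proof cases
        case 1
        then show ?thesis by (intro CollectI exI[of _ 0] exI[of _ 1]) auto
      next
        case 2
        then show ?thesis by (intro CollectI exI[of _ x] exI[of _ 0]) auto
      qed
    qed
    ultimately show "rat_adjoin (insert b S) \<subseteq> ?E"
      by (intro field.generate_field_min_subfield1[OF complex_field]) auto
  next
    have "?F \<subseteq> rat_adjoin (insert b S)" by (rule rat_adjoin_mono) auto
    then show "?E \<subseteq> rat_adjoin (insert b S)"
      using rat_adjoin_incl[of b "insert b S"] by (auto intro!: rat_adjoin_add rat_adjoin_mult)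
  qed
qed

text \<open>A square root of an element of \<open>F\<close> that lies in \<open>F(b)\<close> is in \<open>F\<close>, or its multiple by \<open>b\<close> is.\<close>

lemma sqrt_descent:
  assumes "b\<^sup>2 \<in> rat_adjoin S" and "x\<^sup>2 \<in> rat_adjoin S" and "x \<in> rat_adjoin (insert b S)"
  shows "x \<in> rat_adjoin S \<or> b * x \<in> rat_adjoin S"
proof -
  obtain p q where x: "x = p + q * b" and F: "p \<in> rat_adjoin S" "q \<in> rat_adjoin S"
    using assms(3) rat_adjoin_insert_sqrt[OF assms(1)] by auto
  show ?thesis
  proof (cases "p = 0 \<or> q = 0")
    case True
    then show ?thesis
    proof
      assume "p = 0"
      then have "b * x = q * b\<^sup>2" using x by (simp add: power2_eq_square)
      then show ?thesis using F assms(1) by (auto intro: rat_adjoin_mult)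
    qed (use x F in auto)
  next
    case False
    have "2 * p * q * b = x\<^sup>2 - p\<^sup>2 - q\<^sup>2 * b\<^sup>2"
      unfolding x by (simp add: algebra_simps power2_eq_square)
    then have "b = (x\<^sup>2 - p\<^sup>2 - q\<^sup>2 * b\<^sup>2) / (2 * p * q)"
      using False by (simp add: field_simps)
    also have "\<dots> \<in> rat_adjoin S" by (intro rat_adjoin_closed F assms)
    finally show ?thesis using x F by (auto intro: rat_adjoin_closed)
  qed
qed

text \<open>If \<open>m + n b\<close> is a square in \<open>F(b)\<close>, then its norm is a square in \<open>F\<close>.\<close>

lemma sqrt_norm:
  assumes "b\<^sup>2 \<in> rat_adjoin S" and "b \<notin> rat_adjoin S"
    and "x \<in> rat_adjoin (insert b S)" and "x\<^sup>2 = m + n * b"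
    and "m \<in> rat_adjoin S" "n \<in> rat_adjoin S"
  shows "\<exists>w \<in> rat_adjoin S. w\<^sup>2 = m\<^sup>2 - n\<^sup>2 * b\<^sup>2"
proof -
  obtain p q where x: "x = p + q * b" and F: "p \<in> rat_adjoin S" "q \<in> rat_adjoin S"
    using assms(3) rat_adjoin_insert_sqrt[OF assms(1)] by auto
  have eq: "(p\<^sup>2 + q\<^sup>2 * b\<^sup>2 - m) = (n - 2 * p * q) * b"
    using assms(4) unfolding x by (simp add: algebra_simps power2_eq_square)
  have n: "n = 2 * p * q"
  proof (rule ccontr)
    assume "n \<noteq> 2 * p * q"
    then have "b = (p\<^sup>2 + q\<^sup>2 * b\<^sup>2 - m) / (n - 2 * p * q)" using eq by (simp add: field_simps)
    also have "\<dots> \<in> rat_adjoin S" by (intro rat_adjoin_closed F assms)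
    finally show False using assms(2) by simp
  qed
  with eq have m: "m = p\<^sup>2 + q\<^sup>2 * b\<^sup>2" by simp
  have "(p\<^sup>2 - q\<^sup>2 * b\<^sup>2)\<^sup>2 = m\<^sup>2 - n\<^sup>2 * b\<^sup>2"
    unfolding m n by (simp add: algebra_simps power2_eq_square)
  then show ?thesis by (intro bexI[of _ "p\<^sup>2 - q\<^sup>2 * b\<^sup>2"]) (auto intro!: rat_adjoin_closed F assms)
qed

lemma dimension_insert_sqrt:
  assumes "b\<^sup>2 \<in> rat_adjoin S" and "b \<notin> rat_adjoin S"
  shows "C.dimension 2 (rat_adjoin S) (rat_adjoin (insert b S))"
proof -
  let ?F = "rat_adjoin S"
  have "C.dimension 1 ?F ?F" by (rule C.dimension_one[OF rat_adjoin_subfield])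
  then have "C.dimension (Suc 1) ?F (C.line_extension ?F b ?F)"
    by (intro C.Suc_dim) (use assms in auto)
  moreover have "C.line_extension ?F b ?F = rat_adjoin (insert b S)"
    unfolding rat_adjoin_insert_sqrt[OF assms(1)]
    by (auto simp: C.line_extension_mem_iff) (metis add.commute)+
  ultimately show ?thesis by (simp add: numeral_2_eq_2)
qed

lemma degree_insert_sqrt:
  assumes "b\<^sup>2 \<in> rat_adjoin S" and "b \<notin> rat_adjoin S" and "degree_over_rat (rat_adjoin S) n"
  shows "degree_over_rat (rat_adjoin (insert b S)) (2 * n)"
proof -
  have "subfield \<rat> complex_ring" using rat_adjoin_subfield[of "{}"] rat_adjoin_empty by simp
  then have "degree_over_rat (rat_adjoin (insert b S)) (n * 2)"
    by (rule C.telescopic_base[OF _ rat_adjoin_subfield assms(3) dimension_insert_sqrt[OF assms(1,2)]])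
  then show ?thesis by (simp add: mult.commute)
qed

lemma degree_over_rat_Rats: "degree_over_rat (rat_adjoin {}) 1"
  using C.dimension_one[OF rat_adjoin_subfield, of "{}"] by (simp add: rat_adjoin_empty)

text \<open>
  A number in a field of finite degree is algebraic.  Polynomials over a subset of a ring are lists
  of coefficients, the leading coefficient first; they are turned into the polynomials in terms
  of which \<open>algebraic\<close> is defined.
\<close>

lemma complex_ring_eval: "C.eval p x = poly (Poly (rev p)) x"
proof (induction p)
  case (Cons a p)
  then show ?case by (simp add: Poly_append poly_monom)
qed simp

lemma finite_degree_imp_algebraic:
  assumes "degree_over_rat (rat_adjoin S) n" and "x \<in> rat_adjoin S"
  shows "algebraic x"
proof -
  have Q: "subfield \<rat> complex_ring" using rat_adjoin_subfield[of "{}"] rat_adjoin_empty by simp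
  have "(C.algebraic over \<rat>) x"
    using C.finite_dimension_imp_algebraic[OF Q subfieldE(1)[OF rat_adjoin_subfield]
        C.finite_dimensionI[OF assms(1)] assms(2)] .
  then obtain p where p: "p \<in> carrier (\<rat>[X]\<^bsub>complex_ring\<^esub>)" "p \<noteq> []" "C.eval p x = 0"
    using domain.algebraicE[OF field.axioms(1)[OF complex_field] subfieldE(1)[OF Q], of x] by auto
  then have sub: "set p \<subseteq> \<rat>" and ld: "hd p \<noteq> 0"
    by (auto simp: univ_poly_carrier[symmetric] polynomial_def)
  have "poly.coeff (Poly (rev p)) i \<in> \<rat>" for i
    using sub nth_mem[of i "rev p"] by (auto simp: coeff_Poly_eq nth_default_def simp del: nth_mem)
  moreover have "Poly (rev p) \<noteq> 0"
  proof
    assume "Poly (rev p) = 0"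
    then obtain k where k: "rev p = replicate k 0" by (auto simp: Poly_eq_0)
    have "hd p \<in> set (rev p)" using p(2) by simp
    with k ld show False by auto
  qed
  moreover have "poly (Poly (rev p)) x = 0" using p(3) complex_ring_eval by simp
  ultimately show ?thesis unfolding algebraic_altdef by blast
qed

section \<open>The tower of square roots\<close>

text \<open>
  The real numbers \<open>2\<^sup>1\<^sup>/\<^sup>2\<close>, \<open>2\<^sup>1\<^sup>/\<^sup>4\<close>, \<open>2\<^sup>1\<^sup>/\<^sup>8\<close> and
  \<open>(1 + 2\<^sup>1\<^sup>/\<^sup>2)\<^sup>1\<^sup>/\<^sup>2\<close>, as complex numbers.
\<close>

definition rt2 :: complex where "rt2 = of_real (sqrt 2)"
definition rt4 :: complex where "rt4 = of_real (sqrt (sqrt 2))"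
definition rt8 :: complex where "rt8 = of_real (sqrt (sqrt (sqrt 2)))"
definition unit_rt :: complex where "unit_rt = of_real (sqrt (1 + sqrt 2))"

lemma rt_squares: "rt2\<^sup>2 = 2" "rt4\<^sup>2 = rt2" "rt8\<^sup>2 = rt4" "unit_rt\<^sup>2 = 1 + rt2"
  by (simp_all add: rt2_def rt4_def rt8_def unit_rt_def flip: of_real_power)

lemma rt_Reals: "rt2 \<in> \<real>" "rt4 \<in> \<real>" "rt8 \<in> \<real>" "unit_rt \<in> \<real>"
  by (simp_all add: rt2_def rt4_def rt8_def unit_rt_def)

lemma rt2_eq_csqrt: "rt2 = csqrt 2"
  using csqrt_of_real_nonneg[of 2] by (simp add: rt2_def)

lemma square_in_Reals_nonneg:
  fixes w :: complex
  assumes "w\<^sup>2 = of_real x" and "w \<in> \<real>"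
  shows "x \<ge> 0"
proof -
  obtain v where "w = complex_of_real v" using assms(2) by (auto elim: Reals_cases)
  with assms(1) have "x = v\<^sup>2" by (metis of_real_eq_iff of_real_power)
  then show ?thesis by simp
qed

lemma square_in_Rats_complex:
  fixes w :: complex
  assumes "w\<^sup>2 = of_int k" and "w \<in> \<rat>"
  shows "\<exists>n::int. k = n\<^sup>2"
proof -
  obtain q where w: "w = of_rat q" using assms(2) by (auto elim: Rats_cases)
  then have "of_rat (q\<^sup>2) = (of_rat (of_int k) :: complex)" using assms(1) by (simp add: of_rat_power)
  then have q: "q\<^sup>2 = of_int k" by (simp only: of_rat_eq_iff)
  obtain a b where ab: "quotient_of q = (a, b)" by fastforce
  then have b: "b > 0" "coprime a b" and qab: "q = of_int a / of_int b"
    by (auto simp: quotient_of_denom_pos quotient_of_coprime quotient_of_div)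
  have "of_int (a\<^sup>2) = (of_int (k * b\<^sup>2) :: rat)"
    using q b unfolding qab by (simp add: field_simps power2_eq_square)
  then have eq: "a\<^sup>2 = k * b\<^sup>2" by (simp only: of_int_eq_iff)
  then have "b\<^sup>2 dvd a\<^sup>2" by simp
  then have "b dvd a" by simp
  with b have "b = 1" by (metis coprime_absorb_right zdvd1_eq abs_of_pos)
  with eq show ?thesis by auto
qed

lemma twice_square_not_square:
  fixes k n :: int
  assumes "k \<noteq> 0"
  shows "2 * k\<^sup>2 \<noteq> n\<^sup>2"
proof
  assume eq: "2 * k\<^sup>2 = n\<^sup>2"
  have "multiplicity 2 (2 * k\<^sup>2) = 1 + 2 * multiplicity 2 k"
    using assms by (simp add: prime_elem_multiplicity_mult_distrib prime_elem_multiplicity_power_distrib)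
  moreover have "multiplicity 2 (n\<^sup>2) = 2 * multiplicity 2 n"
    using assms eq by (intro prime_elem_multiplicity_power_distrib) auto
  ultimately have "2 * multiplicity 2 n = 1 + 2 * multiplicity 2 k" using eq by simp
  then show False by presburger
qed

subsection \<open>Square roots of rational numbers and of rational multiples of the fundamental unit\<close>

lemma rt2_notin: "rt2 \<notin> rat_adjoin {}"
proof
  assume "rt2 \<in> rat_adjoin {}"
  then obtain n :: int where "2 = n\<^sup>2"
    using square_in_Rats_complex[of rt2 2] rt_squares rat_adjoin_empty by auto
  then show False using twice_square_not_square[of 1 n] by simp
qed

text \<open>Generators of the fields of the tower, of degree 2, 4, 8 and 16.\<close>

abbreviation Q1 :: "complex set" where "Q1 \<equiv> {rt2}"
abbreviation Q2 :: "complex set" where "Q2 \<equiv> {rt4, rt2}"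
abbreviation Q3 :: "complex set" where "Q3 \<equiv> {rt8, rt4, rt2}"
abbreviation Q4 :: "complex set" where "Q4 \<equiv> {unit_rt, rt8, rt4, rt2}"

lemma real_tower:
  "rat_adjoin Q1 \<subseteq> \<real>" "rat_adjoin Q2 \<subseteq> \<real>" "rat_adjoin Q3 \<subseteq> \<real>" "rat_adjoin Q4 \<subseteq> \<real>"
  by (rule rat_adjoin_Reals; use rt_Reals in simp)+

lemma rt_squares_mem:
  "rt2\<^sup>2 \<in> rat_adjoin {}" "rt4\<^sup>2 \<in> rat_adjoin Q1" "rt8\<^sup>2 \<in> rat_adjoin Q2"
  "unit_rt\<^sup>2 \<in> rat_adjoin Q3"
  unfolding rt_squares by (auto intro!: rat_adjoin_closed intro: rat_adjoin_incl)

lemma neg_not_square: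
  assumes "w \<in> rat_adjoin S" "rat_adjoin S \<subseteq> \<real>" "w\<^sup>2 = of_real x" "x < 0"
  shows False
  using square_in_Reals_nonneg[OF assms(3)] assms(1,2,4) by auto

lemma rt4_notin: "rt4 \<notin> rat_adjoin Q1"
proof
  assume "rt4 \<in> rat_adjoin Q1"
  from sqrt_norm[OF rt_squares_mem(1) rt2_notin this, of 0 1]
  obtain w where "w \<in> rat_adjoin {}" "w\<^sup>2 = - 2" by (auto simp: rt_squares)
  then show False
    using neg_not_square[of w "{}" "- 2"] rat_adjoin_Reals[of "{}"] by simp
qed

text \<open>The norm of \<open>c rt4\<close> to \<open>\<rat>(\<surd>2)\<close> is \<open>- c\<^sup>2 \<surd>2\<close>, which is negative.\<close>

lemma rt8_multiple_notin:
  assumes "x\<^sup>2 = c * rt4" "c \<in> rat_adjoin Q1" "c \<noteq> 0"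
  shows "x \<notin> rat_adjoin Q2"
proof
  assume "x \<in> rat_adjoin Q2"
  from sqrt_norm[OF rt_squares_mem(2) rt4_notin this, of 0 c]
  obtain w where w: "w \<in> rat_adjoin Q1" "w\<^sup>2 = - (c\<^sup>2 * rt2)"
    using assms by (auto simp: rt_squares)
  obtain c' where c': "c = of_real c'" using assms real_tower by (auto elim: Reals_cases)
  have "w\<^sup>2 = of_real (- (c'\<^sup>2 * sqrt 2))" using w(2) by (simp add: c' rt2_def)
  moreover have "- (c'\<^sup>2 * sqrt 2) < 0" using assms(3) c' by simp
  ultimately show False using neg_not_square[OF w(1) real_tower(1)] by blast
qed

lemma rt8_notin: "rt8 \<notin> rat_adjoin Q2"
  by (rule rt8_multiple_notin[of _ 1]) (simp_all add: rt_squares)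

text \<open>Squares among the numbers \<open>m + n \<surd>2\<close> with rational integers \<open>m\<close> and \<open>n\<close>.\<close>

lemma sqrt_norm_rt2:
  assumes "x \<in> rat_adjoin Q1" "x\<^sup>2 = of_int m + of_int n * rt2"
  shows "\<exists>k::int. m\<^sup>2 - 2 * n\<^sup>2 = k\<^sup>2"
proof -
  from sqrt_norm[OF rt_squares_mem(1) rt2_notin assms]
  obtain w where "w \<in> rat_adjoin {}" "w\<^sup>2 = of_int m ^ 2 - of_int n ^ 2 * 2"
    by (auto simp: rt_squares intro: rat_adjoin_of_int)
  then show ?thesis
    using square_in_Rats_complex[of w "m\<^sup>2 - 2 * n\<^sup>2"] rat_adjoin_empty by (simp add: mult.commute)
qed

text \<open>
  Descending from \<open>Q3\<close>, one would find a square root of \<open>k (1 + \<surd>2)\<close> or of \<open>k (2 + \<surd>2)\<close> in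
  \<open>\<rat>(\<surd>2)\<close>; the norms \<open>- k\<^sup>2\<close> and \<open>2 k\<^sup>2\<close> are not squares.
\<close>

lemma unit_multiple_notin:
  fixes k :: int
  assumes k: "k > 0" and x: "x\<^sup>2 = of_int k * (1 + rt2)"
  shows "x \<notin> rat_adjoin Q3"
proof
  assume "x \<in> rat_adjoin Q3"
  have s1: "1 + rt2 \<in> rat_adjoin S" if "rt2 \<in> S" for S
    using that by (intro rat_adjoin_closed rat_adjoin_incl)
  have xm: "x\<^sup>2 \<in> rat_adjoin S" if "rt2 \<in> S" for S
    unfolding x using rat_adjoin_incl[OF that] by (intro rat_adjoin_closed)
  have n0: "1 + rt2 \<noteq> 0"
  proof -
    have "1 + sqrt 2 \<noteq> 0" using real_sqrt_ge_zero[of 2] by linarith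
    then show ?thesis unfolding rt2_def using of_real_eq_0_iff[of "1 + sqrt 2"] by simp
  qed
  from sqrt_descent[OF rt_squares_mem(3) xm \<open>x \<in> rat_adjoin Q3\<close>]
  have "x \<in> rat_adjoin Q2 \<or> rt8 * x \<in> rat_adjoin Q2" by simp
  moreover have "rt8 * x \<notin> rat_adjoin Q2"
    by (rule rt8_multiple_notin[of _ "of_int k * (1 + rt2)"])
      (use k n0 in \<open>auto simp: power_mult_distrib rt_squares x intro!: rat_adjoin_mult rat_adjoin_of_int s1\<close>)
  ultimately have "x \<in> rat_adjoin Q2" by simp
  from sqrt_descent[OF rt_squares_mem(2) xm this]
  have "x \<in> rat_adjoin Q1 \<or> rt4 * x \<in> rat_adjoin Q1" by simp
  then show False
  proof
    assume "x \<in> rat_adjoin Q1"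
    moreover have "x\<^sup>2 = of_int k + of_int k * rt2" unfolding x by (simp add: algebra_simps)
    ultimately obtain j :: int where "k\<^sup>2 - 2 * k\<^sup>2 = j\<^sup>2" using sqrt_norm_rt2 by blast
    moreover have "k\<^sup>2 > 0" "j\<^sup>2 \<ge> 0" using k by auto
    ultimately show False by linarith
  next
    assume "rt4 * x \<in> rat_adjoin Q1"
    moreover have "(rt4 * x)\<^sup>2 = of_int (2 * k) + of_int k * rt2"
    proof -
      have "(rt4 * x)\<^sup>2 = of_int k * (rt2 + rt2\<^sup>2)"
        by (simp add: power_mult_distrib rt_squares(2) x) (simp add: algebra_simps power2_eq_square)
      then show ?thesis by (simp add: rt_squares(1) algebra_simps)
    qed
    ultimately obtain j :: int where "(2 * k)\<^sup>2 - 2 * k\<^sup>2 = j\<^sup>2" using sqrt_norm_rt2 by blast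
    then have "2 * k\<^sup>2 = j\<^sup>2" by (simp add: power_mult_distrib)
    then show False using twice_square_not_square[of k j] k by simp
  qed
qed

lemma unit_rt_notin: "unit_rt \<notin> rat_adjoin Q3"
  by (rule unit_multiple_notin[of 1]) (simp_all add: rt_squares)

lemma squarefree_square:
  fixes k n :: int
  assumes "squarefree k" "k > 0" "n\<^sup>2 = k"
  shows "k = 1"
proof -
  have "n\<^sup>2 dvd k" using assms(3) by simp
  then have "n dvd 1" using assms(1) unfolding squarefree_def by blast
  then show ?thesis using assms(3) by (auto simp: zdvd1_eq abs_if split: if_splits)
qed

lemma squarefree_twice_square:
  fixes k n :: int
  assumes "squarefree k" "k > 0" "n\<^sup>2 = 2 * k"
  shows "k = 2"
proof -
  have "even (n\<^sup>2)" using assms(3) by simp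
  then obtain m where m: "n = 2 * m" by auto
  then have "k = 2 * m\<^sup>2" using assms(3) by (simp add: power_mult_distrib)
  moreover from this have "m dvd 1" using assms(1) unfolding squarefree_def by simp
  ultimately show ?thesis by (auto simp: zdvd1_eq abs_if split: if_splits)
qed

lemma sqrt_int_notin:
  fixes k :: int
  assumes k: "k > 0" "squarefree k" "k \<noteq> 1" "k \<noteq> 2" and x: "x\<^sup>2 = of_int k"
  shows "x \<notin> rat_adjoin Q4"
proof
  assume "x \<in> rat_adjoin Q4"
  have xm: "x\<^sup>2 \<in> rat_adjoin S" for S
    unfolding x by (intro rat_adjoin_closed)
  from sqrt_descent[OF rt_squares_mem(4) xm \<open>x \<in> rat_adjoin Q4\<close>]
  have "x \<in> rat_adjoin Q3 \<or> unit_rt * x \<in> rat_adjoin Q3" by simp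
  moreover have "unit_rt * x \<notin> rat_adjoin Q3"
    by (rule unit_multiple_notin[OF k(1)]) (simp add: power_mult_distrib rt_squares x)
  ultimately have "x \<in> rat_adjoin Q3" by simp
  from sqrt_descent[OF rt_squares_mem(3) xm this]
  have "x \<in> rat_adjoin Q2 \<or> rt8 * x \<in> rat_adjoin Q2" by simp
  moreover have "rt8 * x \<notin> rat_adjoin Q2"
    by (rule rt8_multiple_notin[of _ "of_int k"])
      (use k in \<open>auto simp: power_mult_distrib rt_squares x intro: rat_adjoin_of_int\<close>)
  ultimately have "x \<in> rat_adjoin Q2" by simp
  from sqrt_descent[OF rt_squares_mem(2) xm this]
  have "x \<in> rat_adjoin Q1 \<or> rt4 * x \<in> rat_adjoin Q1" by simp
  moreover have "rt4 * x \<notin> rat_adjoin Q1"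
  proof
    assume "rt4 * x \<in> rat_adjoin Q1"
    moreover have "(rt4 * x)\<^sup>2 = of_int 0 + of_int k * rt2"
      by (simp add: power_mult_distrib rt_squares x)
    ultimately obtain j :: int where "0\<^sup>2 - 2 * k\<^sup>2 = j\<^sup>2" using sqrt_norm_rt2 by blast
    then have "- (2 * k\<^sup>2) = j\<^sup>2" by simp
    moreover have "k\<^sup>2 > 0" "j\<^sup>2 \<ge> 0" using k by auto
    ultimately show False by linarith
  qed
  ultimately have "x \<in> rat_adjoin Q1" by simp
  from sqrt_descent[OF rt_squares_mem(1) xm this]
  have "x \<in> \<rat> \<or> rt2 * x \<in> \<rat>" by (simp add: rat_adjoin_empty)
  then show False
  proof
    assume "x \<in> \<rat>"
    then obtain n :: int where n: "k = n\<^sup>2" using square_in_Rats_complex[OF x] by blast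
    show False using squarefree_square[OF k(2,1) n[symmetric]] k(3) by contradiction
  next
    assume "rt2 * x \<in> \<rat>"
    moreover have "(rt2 * x)\<^sup>2 = of_int (2 * k)" by (simp add: power_mult_distrib rt_squares x)
    ultimately obtain n :: int where n: "2 * k = n\<^sup>2" using square_in_Rats_complex by blast
    show False using squarefree_twice_square[OF k(2,1) n[symmetric]] k(4) by contradiction
  qed
qed

subsection \<open>Adjoining the imaginary unit\<close>

lemma ii_square_mem: "\<i>\<^sup>2 \<in> rat_adjoin S"
  using rat_adjoin_uminus[OF rat_adjoin_one] by simp

lemma ii_notin: "rat_adjoin S \<subseteq> \<real> \<Longrightarrow> \<i> \<notin> rat_adjoin S"
  by (auto simp: complex_is_Real_iff dest: subsetD)

lemma real_in_insert_ii:
  assumes "rat_adjoin S \<subseteq> \<real>" and "x \<in> rat_adjoin (insert \<i> S)" and "x \<in> \<real>"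
  shows "x \<in> rat_adjoin S"
proof -
  obtain p q where x: "x = p + q * \<i>" and F: "p \<in> rat_adjoin S" "q \<in> rat_adjoin S"
    using assms(2) unfolding rat_adjoin_insert_sqrt[OF ii_square_mem] by blast
  have "p \<in> \<real>" "q \<in> \<real>" using F assms(1) by auto
  then have "q = 0" using assms(3) x by (auto simp: complex_is_Real_iff complex_eq_iff)
  then show ?thesis using x F by simp
qed

lemma csqrt_int_notin:
  fixes d :: int
  assumes d: "d \<noteq> 0" "squarefree d" "d \<notin> {1, - 1, 2, - 2}"
  shows "csqrt (of_int d) \<notin> rat_adjoin (insert \<i> Q4)"
proof
  assume mem: "csqrt (of_int d) \<in> rat_adjoin (insert \<i> Q4)"
  define x :: complex where "x = of_real (sqrt \<bar>of_int d\<bar>)"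
  have x2: "x\<^sup>2 = of_int \<bar>d\<bar>"
    unfolding x_def by (simp add: abs_if flip: of_real_power)
  have "x\<^sup>2 = (csqrt (of_int d))\<^sup>2 \<or> x\<^sup>2 = (\<i> * csqrt (of_int d))\<^sup>2"
    unfolding x2 by (simp add: power_mult_distrib abs_if)
  then have "x \<in> {csqrt (of_int d), - csqrt (of_int d), \<i> * csqrt (of_int d), - (\<i> * csqrt (of_int d))}"
    unfolding power2_eq_iff by blast
  moreover have "\<i> \<in> rat_adjoin (insert \<i> Q4)" by (simp add: rat_adjoin_incl)
  ultimately have "x \<in> rat_adjoin (insert \<i> Q4)"
    using mem by (auto intro!: rat_adjoin_uminus rat_adjoin_mult)
  then have "x \<in> rat_adjoin Q4"
    by (rule real_in_insert_ii[OF real_tower(4)]) (simp add: x_def)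
  moreover have "x \<notin> rat_adjoin Q4"
    by (rule sqrt_int_notin[of "\<bar>d\<bar>", OF _ _ _ _ x2]) (use d in \<open>auto simp: abs_if\<close>)
  ultimately show False by simp
qed

subsection \<open>Degrees\<close>

lemma degree_Q1: "degree_over_rat (rat_adjoin Q1) 2"
  using degree_insert_sqrt[OF rt_squares_mem(1) rt2_notin degree_over_rat_Rats] by simp

lemma degree_Q2: "degree_over_rat (rat_adjoin Q2) 4"
  using degree_insert_sqrt[OF rt_squares_mem(2) rt4_notin degree_Q1] by simp

lemma degree_Q3: "degree_over_rat (rat_adjoin Q3) 8"
  using degree_insert_sqrt[OF rt_squares_mem(3) rt8_notin degree_Q2] by simp

lemma degree_Q4: "degree_over_rat (rat_adjoin Q4) 16"
  using degree_insert_sqrt[OF rt_squares_mem(4) unit_rt_notin degree_Q3] by simp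

lemma degree_insert_ii:
  assumes "rat_adjoin S \<subseteq> \<real>" "degree_over_rat (rat_adjoin S) n"
  shows "degree_over_rat (rat_adjoin (insert \<i> S)) (2 * n)"
  by (rule degree_insert_sqrt[OF ii_square_mem ii_notin[OF assms(1)] assms(2)])

lemma degree_insert_csqrt_int:
  fixes d :: int
  assumes d: "d \<noteq> 0" "squarefree d" and S: "S \<subseteq> insert \<i> Q4" "\<i> \<in> S" "rt2 \<in> S"
    and n: "degree_over_rat (rat_adjoin S) n"
  shows "degree_over_rat (rat_adjoin (insert (csqrt (of_int d)) S))
    (if d \<in> {1, - 1, 2, - 2} then n else 2 * n)"
proof (cases "d \<in> {1, - 1, 2, - 2}")
  case True
  have i: "\<i> \<in> rat_adjoin S" "rt2 \<in> rat_adjoin S" using S by (auto intro: rat_adjoin_incl)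
  have "(csqrt (of_int d))\<^sup>2 = of_int d" by simp
  with True have "(csqrt (of_int d))\<^sup>2 \<in> {1\<^sup>2, \<i>\<^sup>2, rt2\<^sup>2, (\<i> * rt2)\<^sup>2}"
    by (auto simp: rt_squares power_mult_distrib)
  then have "csqrt (of_int d) \<in> {1, \<i>, rt2, \<i> * rt2, - 1, - \<i>, - rt2, - (\<i> * rt2)}"
    by (simp only: power2_eq_iff insert_iff empty_iff) blast
  then have "csqrt (of_int d) \<in> rat_adjoin S"
    using i by (auto intro!: rat_adjoin_closed)
  then show ?thesis using True n by (simp only: rat_adjoin_insert_absorb if_True)
next
  case False
  have "csqrt (of_int d) \<notin> rat_adjoin S"
    using csqrt_int_notin[OF d False] rat_adjoin_mono[OF S(1)] by blast
  moreover have "(csqrt (of_int d))\<^sup>2 \<in> rat_adjoin S" by (simp add: rat_adjoin_of_int)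
  ultimately show ?thesis
    using degree_insert_sqrt[OF _ _ n] False by (simp only: if_False)
qed

section \<open>The fields generated by a root of \<open>f4\<close> or \<open>f8\<close>\<close>

text \<open>
  The square roots chosen in the tower do not matter: any other choice lies in the same field.
\<close>

lemma fourth_power_eq_cases:
  fixes a b i :: complex
  assumes "i\<^sup>2 = - 1" "a ^ 4 = b ^ 4"
  shows "a = b \<or> a = - b \<or> a = i * b \<or> a = - (i * b)"
proof -
  have "(a - b) * (a + b) * ((a - i * b) * (a + i * b)) = (a\<^sup>2 - b\<^sup>2) * (a\<^sup>2 - i\<^sup>2 * b\<^sup>2)"
    by (simp add: algebra_simps power2_eq_square)
  also have "\<dots> = a ^ 4 - b ^ 4"
    unfolding assms(1) by (simp add: algebra_simps flip: power_add)
  finally show ?thesis using assms(2) by (auto simp: add_eq_0_iff2)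
qed

lemma tower4_mem:
  fixes i r j q :: complex
  assumes i: "i\<^sup>2 = - 1" "r ^ 4 = 2" and j: "j\<^sup>2 = - 1" "q ^ 4 = 2"
    and F: "i \<in> rat_adjoin S" "r \<in> rat_adjoin S"
  shows "j \<in> rat_adjoin S \<and> q \<in> rat_adjoin S"
proof
  have "j = i \<or> j = - i" using i j by (simp flip: power2_eq_iff)
  then show "j \<in> rat_adjoin S" using F by (auto intro: rat_adjoin_uminus)
  have "q = r \<or> q = - r \<or> q = i * r \<or> q = - (i * r)"
    using fourth_power_eq_cases[OF i(1), of q r] i j by simp
  then show "q \<in> rat_adjoin S" using F by (auto intro!: rat_adjoin_closed)
qed

lemma tower8_mem:
  fixes i t u j q v :: complex
  assumes i: "i\<^sup>2 = - 1" "t ^ 8 = 2" "u\<^sup>2 = 1 + t ^ 4"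
    and j: "j\<^sup>2 = - 1" "q ^ 8 = 2" "v\<^sup>2 = 1 + q ^ 4"
    and F: "i \<in> rat_adjoin S" "t \<in> rat_adjoin S" "u \<in> rat_adjoin S"
  shows "j \<in> rat_adjoin S \<and> q \<in> rat_adjoin S \<and> v \<in> rat_adjoin S"
proof (intro conjI)
  have "j = i \<or> j = - i" using i j by (simp flip: power2_eq_iff)
  then show "j \<in> rat_adjoin S" using F by (auto intro: rat_adjoin_uminus)
  have t: "t \<noteq> 0" "(t ^ 4)\<^sup>2 = 2" using i by auto
  define z where "z = t ^ 4 * (1 + i) / 2"
  have z: "z\<^sup>2 = i"
  proof -
    have "z\<^sup>2 = (t ^ 4)\<^sup>2 * (1 + i)\<^sup>2 / 4"
      unfolding z_def by (simp add: power_divide power_mult_distrib)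
    also have "\<dots> = i" unfolding t using i by (simp add: power2_eq_square algebra_simps)
    finally show ?thesis .
  qed
  have zF: "z \<in> rat_adjoin S" unfolding z_def using F by (intro rat_adjoin_closed)
  have q8: "(q\<^sup>2) ^ 4 = 2" "(t\<^sup>2) ^ 4 = 2" using i j by (simp_all flip: power_mult)
  have "q\<^sup>2 = t\<^sup>2 \<or> q\<^sup>2 = - t\<^sup>2 \<or> q\<^sup>2 = i * t\<^sup>2 \<or> q\<^sup>2 = - (i * t\<^sup>2)"
    using fourth_power_eq_cases[OF i(1), of "q\<^sup>2" "t\<^sup>2"] q8 by simp
  then have "q\<^sup>2 = t\<^sup>2 \<or> q\<^sup>2 = (i * t)\<^sup>2 \<or> q\<^sup>2 = (z * t)\<^sup>2 \<or> q\<^sup>2 = (i * z * t)\<^sup>2"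
    using i(1) z by (auto simp: power_mult_distrib)
  then have "q \<in> {t, - t, i * t, - (i * t), z * t, - (z * t), i * z * t, - (i * z * t)}"
    by (simp only: power2_eq_iff insert_iff empty_iff) blast
  then show "q \<in> rat_adjoin S" using F zF by (auto intro!: rat_adjoin_closed)
  have "(q ^ 4)\<^sup>2 = (t ^ 4)\<^sup>2" using i j by (simp flip: power_mult)
  then have "q ^ 4 = t ^ 4 \<or> q ^ 4 = - (t ^ 4)" unfolding power2_eq_iff .
  then show "v \<in> rat_adjoin S"
  proof
    assume "q ^ 4 = t ^ 4"
    then have "v = u \<or> v = - u" using i j by (simp flip: power2_eq_iff)
    then show ?thesis using F by (auto intro: rat_adjoin_uminus)
  next
    \<comment> \<open>the conjugate of \<open>1 + t ^ 4\<close> is the negative of its inverse\<close>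
    assume q: "q ^ 4 = - (t ^ 4)"
    have "(1 - t ^ 4) * (1 + t ^ 4) = - 1" using t(2) by (simp add: algebra_simps power2_eq_square)
    then have "v\<^sup>2 * u\<^sup>2 = i\<^sup>2" unfolding i(3) j(3) q i(1) by simp
    then have "v * u = i \<or> v * u = - i" by (simp flip: power_mult_distrib add: power2_eq_iff)
    moreover have "u \<noteq> 0" using \<open>v\<^sup>2 * u\<^sup>2 = i\<^sup>2\<close> i(1) by auto
    ultimately have "v = i / u \<or> v = - i / u" by (auto simp: field_simps)
    then show ?thesis using F by (auto intro!: rat_adjoin_closed)
  qed
qed

lemma power_as_squares: "a ^ 4 = (a\<^sup>2)\<^sup>2" "a ^ 8 = ((a\<^sup>2)\<^sup>2)\<^sup>2" for a :: complex
  by (simp_all flip: power_mult)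

lemma rt4_power: "rt4 ^ 4 = 2"
  unfolding power_as_squares rt_squares ..

lemma rt8_power: "rt8 ^ 4 = rt2" "rt8 ^ 8 = 2"
  unfolding power_as_squares rt_squares by simp_all

text \<open>
  With \<open>y = x\<^sup>2\<close> the polynomial is \<open>(y - 1)\<^sup>4 + 2 y\<^sup>2\<close>, so \<open>(y - 1)\<^sup>2 / y\<close> is a square root of \<open>- 2\<close>.
\<close>

lemma f4_root_field:
  assumes "f4 x = 0"
  shows "rat_adjoin {x} = rat_adjoin {\<i>, rt4}"
proof -
  have x: "x \<noteq> 0" using assms by (auto simp: f4_def)
  define y where "y = x\<^sup>2"
  have y: "y \<noteq> 0" using x by (simp add: y_def)
  have "y ^ 4 - 4 * y ^ 3 + 8 * y\<^sup>2 - 4 * y + 1 = 0"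
    using assms unfolding f4_def y_def by (simp flip: power_mult)
  then have f: "((y - 1)\<^sup>2)\<^sup>2 = - 2 * y\<^sup>2" by Groebner_Basis.algebra
  \<comment> \<open>square roots of \<open>- 2\<close>, of \<open>4 sg - 2\<close>, of \<open>2\<close> and of \<open>- 1\<close>, and a fourth root of \<open>2\<close>\<close>
  define sg where "sg = (y - 1)\<^sup>2 / y"
  have sgy: "(y - 1)\<^sup>2 = sg * y" using y by (simp add: sg_def)
  have sg: "sg\<^sup>2 = - 2" using f y unfolding sg_def by (simp add: power_divide)
  define w where "w = 2 * y - 2 - sg"
  have w: "w\<^sup>2 = 4 * sg - 2" using sgy sg unfolding w_def by Groebner_Basis.algebra
  define s where "s = (sg - 1) * w / 3"
  define j where "j = (w + s) / 2"
  have s3: "3 * s = (sg - 1) * w" and j2: "2 * j = w + s" by (simp_all add: s_def j_def)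
  have "9 * s\<^sup>2 = 9 * 2" using s3 sg w by Groebner_Basis.algebra
  then have s: "s\<^sup>2 = 2" by simp
  have "36 * j\<^sup>2 = 36 * (- 1)" using s3 j2 sg w by Groebner_Basis.algebra
  then have j: "j\<^sup>2 = - 1" by simp
  have "18 * (j * s) = 18 * (- sg)" using s3 j2 sg w by Groebner_Basis.algebra
  then have js: "j * s = - sg" by simp
  have yjs: "2 * y = (1 + j) * (2 - s)" using w_def j2 js by (simp add: algebra_simps)
  define c where "c = - 1 + j - j * s"
  have c2: "s * c\<^sup>2 = 4 * y" using yjs s j unfolding c_def by Groebner_Basis.algebra
  then have c: "c \<noteq> 0" using y by auto
  define q where "q = 2 * x / c"
  have xq: "x = q * (- 1 + j - j * s) / 2" using c unfolding q_def c_def by simp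
  have "q\<^sup>2 * c\<^sup>2 = s * c\<^sup>2" unfolding c2 y_def q_def using c by (simp add: power_divide power_mult_distrib)
  then have q2: "q\<^sup>2 = s" using c by simp
  then have q: "q ^ 4 = 2" unfolding power_as_squares using q2 s by simp
  let ?F = "rat_adjoin {x}"
  have xF: "x \<in> ?F" by (simp add: rat_adjoin_incl)
  have F: "y \<in> ?F" unfolding y_def using xF by (intro rat_adjoin_closed)
  then have "sg \<in> ?F" unfolding sg_def by (intro rat_adjoin_closed)
  then have "w \<in> ?F" unfolding w_def using F by (intro rat_adjoin_closed)
  then have sF: "s \<in> ?F" unfolding s_def using \<open>sg \<in> ?F\<close> by (intro rat_adjoin_closed)
  then have jF: "j \<in> ?F" unfolding j_def using \<open>w \<in> ?F\<close> by (intro rat_adjoin_closed)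
  then have "q \<in> ?F" unfolding q_def c_def using sF xF by (intro rat_adjoin_closed)
  with jF have 1: "\<i> \<in> ?F \<and> rt4 \<in> ?F"
    by (intro tower4_mem[OF j q]) (auto simp: rt4_power)
  let ?K = "rat_adjoin {\<i>, rt4}"
  have K: "j \<in> ?K \<and> q \<in> ?K"
    by (rule tower4_mem[OF _ rt4_power j q]) (auto intro: rat_adjoin_incl)
  then have "x \<in> ?K"
    unfolding xq q2[symmetric] by (intro rat_adjoin_closed) auto
  with 1 show ?thesis by (intro rat_adjoin_eqI) auto
qed

text \<open>
  Factors of \<open>f8\<close> over the tower \<open>\<rat> \<subset> \<rat>(j) \<subset> \<rat>(j, s) \<subset> \<rat>(j, r)\<close> with \<open>j\<^sup>2 = - 1\<close>, \<open>s\<^sup>2 = 2\<close>,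
  \<open>r\<^sup>2 = s\<close>: the factors are \<open>f8_re + j f8_im\<close>, then \<open>f8_oct0 j + s f8_oct1 j\<close>, then
  \<open>f8_quart0 j s + r f8_quart1 j s\<close>, of degree 16, 8 and 4.
\<close>

definition f8_re :: "complex \<Rightarrow> complex" where
  "f8_re x =
      x^16 + 8 * x^15 + 28 * x^14 + 56 * x^13 + 76 * x^12 + 88 * x^11 + 92 * x^10 + 64 * x^9
      + 18 * x^8 + 32 * x^6 + 112 * x^5 + 84 * x^4 - 64 * x^3 + 16 * x - 2"

definition f8_im :: "complex \<Rightarrow> complex" where
  "f8_im x =
      4 * x^14 + 32 * x^13 + 124 * x^12 + 296 * x^11 + 460 * x^10 + 432 * x^9 + 182 * x^8
      - 48 * x^7 - 88 * x^6 - 16 * x^5 + 92 * x^4 + 16 * x^3 - 48 * x^2 + 16 * x + 2"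

definition f8_oct0 :: "complex \<Rightarrow> complex \<Rightarrow> complex" where
  "f8_oct0 j x =
      x^8 + 4 * x^7 + (6 - 6 * j) * x^6 + (4 - 24 * j) * x^5 + (6 - 30 * j) * x^4 + (4
      - 12 * j) * x^3 + (6 - 10 * j) * x^2 + (8 - 8 * j) * x + 1 + j"

definition f8_oct1 :: "complex \<Rightarrow> complex \<Rightarrow> complex" where
  "f8_oct1 j x =
      (2 - 2 * j) * x^7 + (8 - 8 * j) * x^6 + (10 - 14 * j) * x^5 + (- 1 - 17 * j) * x^4
      - 16 * j * x^3 + (8 - 6 * j) * x^2 + (4 - 4 * j) * x + 1"

definition f8_quart0 :: "complex \<Rightarrow> complex \<Rightarrow> complex \<Rightarrow> complex" where
  "f8_quart0 j s x =
      x^4 + (2 + s - j * s) * x^3 + (1 - j + 2 * s - 2 * j * s) * x^2 + (- 2 * j + s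
      - j * s) * x + 1 + 1/2 * s + 1/2 * j * s"

definition f8_quart1 :: "complex \<Rightarrow> complex \<Rightarrow> complex \<Rightarrow> complex" where
  "f8_quart1 j s x =
      (1 + j - s) * x^2 + 2 * j * x + 1/2 * s + 1/2 * j * s"

lemma f8_eq: "f8 x = (f8_re x)\<^sup>2 + (f8_im x)\<^sup>2"
  unfolding f8_def f8_re_def f8_im_def by Groebner_Basis.algebra

lemma f8_re_im_eq:
  assumes "j\<^sup>2 = - 1"
  shows "f8_re x + j * f8_im x = (f8_oct0 j x)\<^sup>2 - 2 * (f8_oct1 j x)\<^sup>2"
  using assms unfolding f8_re_def f8_im_def f8_oct0_def f8_oct1_def by Groebner_Basis.algebra

lemma f8_oct_eq:
  assumes "j\<^sup>2 = - 1" "s\<^sup>2 = 2"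
  shows "f8_oct0 j x + s * f8_oct1 j x = (f8_quart0 j s x)\<^sup>2 - s * (f8_quart1 j s x)\<^sup>2"
  using assms unfolding f8_oct0_def f8_oct1_def f8_quart0_def f8_quart1_def by Groebner_Basis.algebra

text \<open>
  In each step the two components have no common root; hence the square root that was adjoined
  is a quotient of values at a root of \<open>f8\<close>.
\<close>

lemma f8_re_im_coprime: "f8_re x \<noteq> 0 \<or> f8_im x \<noteq> 0"
proof (rule ccontr)
  assume "\<not> ?thesis"
  then have "f8_re x = 0" "f8_im x = 0" by auto
  then show False unfolding f8_re_def f8_im_def by Groebner_Basis.algebra
qed

lemma f8_oct_coprime:
  assumes "j\<^sup>2 = - 1"
  shows "f8_oct0 j x \<noteq> 0 \<or> f8_oct1 j x \<noteq> 0"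
proof -
  \<comment> \<open>a Bezout identity\<close>
  have "((- 12054179352128 - 34955167501928 * j) * x^6 + (- 48419516679824
      - 137805877272560 * j) * x^5 + (- 111387045382080 - 196381011395728 * j) * x^4
      + (- 216230946983608 - 93231495007856 * j) * x^3 + (- 202616769171128
      - 99505039152160 * j) * x^2 + (- 57105746000936 - 114592621124592 * j) * x
      - 49356239129152 - 66703228792246 * j) * f8_oct0 j x +
      ((- 5725247037450 + 11752336713514 * j) * x^7 + (- 22346590148184
      + 46556348488096 * j) * x^6 + (37513192064158 + 105568249381702 * j) * x^5
      + (257655437077661 + 186235937720061 * j) * x^4 + (323628426543776
      + 241415477443488 * j) * x^3 + (157068535800984 + 115152802887038 * j) * x^2
      + (119504291979588 + 133483117327036 * j) * x + 71811676145587 + 116059467921398 * j) * f8_oct1 j x =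
      89158665808681"
    unfolding f8_oct0_def f8_oct1_def using assms by Groebner_Basis.algebra
  then show ?thesis by auto
qed

lemma f8_quart_coprime:
  assumes "j\<^sup>2 = - 1" "s\<^sup>2 = 2"
  shows "f8_quart0 j s x \<noteq> 0 \<or> f8_quart1 j s x \<noteq> 0"
proof -
  have "(- 4 + 4 * j + 4 * s - 4 * j * s) * f8_quart0 j s x +
      ((2 - 2 * j + 2 * j * s) * x^2 + 4 * x + 4 + 4 * j - s - 3 * j * s) * f8_quart1 j s x =
      6"
    unfolding f8_quart0_def f8_quart1_def using assms by Groebner_Basis.algebra
  then show ?thesis by auto
qed

text \<open>Completing the square twice in the quartic factor.\<close>

lemma f8_quart_eq:
  assumes j: "j\<^sup>2 = - 1" and s: "s\<^sup>2 = 2" and r: "r\<^sup>2 = s"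
    and z: "2 * z = s * (1 - j)" and e: "e = (r + j) * (1 - z)" and y: "y = 2 * x + 1 + z"
  shows "16 * (f8_quart0 j s x + r * f8_quart1 j s x) =
    (y\<^sup>2 - 2 * (r * s) - (1 + s) * e\<^sup>2)\<^sup>2 - 8 * (r * s) * (1 + s) * e\<^sup>2"
  unfolding f8_quart0_def f8_quart1_def e y using j s r z by Groebner_Basis.algebra

text \<open>
  The roots are \<open>x = (t r s + u (r + j) (1 - z) - 1 - z) / 2\<close>, where \<open>t\<^sup>2 = r\<close>, \<open>u\<^sup>2 = 1 + s\<close> and
  \<open>z = s (1 - j) / 2\<close> is a primitive eighth root of unity.
\<close>

lemma f8_root_field:
  assumes "f8 x = 0"
  shows "rat_adjoin {x} = rat_adjoin {\<i>, rt8, unit_rt}"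
proof -
  let ?F = "rat_adjoin {x}"
  have xF: "x \<in> ?F" by (simp add: rat_adjoin_incl)
  have "(f8_re x + \<i> * f8_im x) * (f8_re x + (- \<i>) * f8_im x) = 0"
    using assms unfolding f8_eq by (simp add: algebra_simps power2_eq_square)
  then obtain j where j: "j\<^sup>2 = - 1" and j0: "f8_re x + j * f8_im x = 0"
    by (metis mult_eq_0_iff power2_i power2_minus)
  have "f8_im x \<noteq> 0" using f8_re_im_coprime[of x] j0 by auto
  then have "j = - f8_re x / f8_im x" using j0 by (simp add: field_simps add_eq_0_iff)
  then have jF: "j \<in> ?F"
    using xF unfolding f8_re_def f8_im_def by (simp only:) (intro rat_adjoin_closed)
  have "(f8_oct0 j x + rt2 * f8_oct1 j x) * (f8_oct0 j x + (- rt2) * f8_oct1 j x) =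
      (f8_oct0 j x)\<^sup>2 - rt2\<^sup>2 * (f8_oct1 j x)\<^sup>2"
    by (simp add: algebra_simps power2_eq_square)
  also have "\<dots> = 0" using f8_re_im_eq[OF j, of x] j0 rt_squares(1) by simp
  finally obtain s where s: "s\<^sup>2 = 2" and s0: "f8_oct0 j x + s * f8_oct1 j x = 0"
    by (metis mult_eq_0_iff rt_squares(1) power2_minus)
  have "f8_oct1 j x \<noteq> 0" using f8_oct_coprime[OF j, of x] s0 by auto
  then have "s = - f8_oct0 j x / f8_oct1 j x" using s0 by (simp add: field_simps add_eq_0_iff)
  then have sF: "s \<in> ?F"
    using xF jF unfolding f8_oct0_def f8_oct1_def by (simp only:) (intro rat_adjoin_closed)
  have "(f8_quart0 j s x + csqrt s * f8_quart1 j s x) *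
      (f8_quart0 j s x + (- csqrt s) * f8_quart1 j s x) =
      (f8_quart0 j s x)\<^sup>2 - (csqrt s)\<^sup>2 * (f8_quart1 j s x)\<^sup>2"
    by (simp add: algebra_simps power2_eq_square)
  also have "\<dots> = 0" using f8_oct_eq[OF j s, of x] s0 by simp
  finally obtain r where r: "r\<^sup>2 = s" and r0: "f8_quart0 j s x + r * f8_quart1 j s x = 0"
    by (metis mult_eq_0_iff power2_csqrt power2_minus)
  have "f8_quart1 j s x \<noteq> 0" using f8_quart_coprime[OF j s, of x] r0 by auto
  then have "r = - f8_quart0 j s x / f8_quart1 j s x" using r0 by (simp add: field_simps add_eq_0_iff)
  then have rF: "r \<in> ?F"
    using xF jF sF unfolding f8_quart0_def f8_quart1_def by (simp only:) (intro rat_adjoin_closed)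
  define z where "z = s * (1 - j) / 2"
  have z2: "2 * z = s * (1 - j)" by (simp add: z_def)
  define e where "e = (r + j) * (1 - z)"
  define y where "y = 2 * x + 1 + z"
  have zF: "z \<in> ?F" unfolding z_def using sF jF by (intro rat_adjoin_closed)
  have eF: "e \<in> ?F" unfolding e_def using rF jF zF by (intro rat_adjoin_closed)
  have yF: "y \<in> ?F" unfolding y_def using xF zF by (intro rat_adjoin_closed)
  have q: "(y\<^sup>2 - 2 * (r * s) - (1 + s) * e\<^sup>2)\<^sup>2 = 8 * (r * s) * (1 + s) * e\<^sup>2"
    using f8_quart_eq[OF j s r z2 e_def y_def] r0 by simp
  have nz: "s \<noteq> 0" "r \<noteq> 0" using s r by auto
  have "e \<noteq> 0"
  proof
    assume "e = 0"
    then consider "r = - j" | "z = 1" unfolding e_def by (auto simp: add_eq_0_iff2)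
    then show False
    proof cases
      case 1
      then have "s = - 1" using r j by simp
      with s show False by simp
    next
      case 2
      have "4 * z\<^sup>2 = 4 * (- j)" using z2 s j by Groebner_Basis.algebra
      then have "z\<^sup>2 = - j" by simp
      then have "(- j)\<^sup>2 = 1" using 2 by simp
      with j show False by simp
    qed
  qed
  define t where "t = csqrt r"
  have t2: "t\<^sup>2 = r" by (simp add: t_def)
  \<comment> \<open>\<open>m\<close> is the product of \<open>t\<close> and a square root of \<open>1 + s\<close>, by the quartic equation for \<open>y\<close>\<close>
  define m where "m = (y\<^sup>2 - 2 * (r * s) - (1 + s) * e\<^sup>2) / (2 * (r * s) * e)"
  have mF: "m \<in> ?F"
    unfolding m_def using rF sF eF yF by (intro rat_adjoin_closed)
  have me: "2 * (r * s) * e * m = y\<^sup>2 - 2 * (r * s) - (1 + s) * e\<^sup>2"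
    unfolding m_def using nz \<open>e \<noteq> 0\<close> by simp
  have rs: "(r * s)\<^sup>2 = 2 * s" using r s by (simp add: power_mult_distrib)
  have "(2 * (r * s) * e)\<^sup>2 * m\<^sup>2 = 8 * (r * s) * (1 + s) * e\<^sup>2"
    using q unfolding me[symmetric] by (simp add: power_mult_distrib)
  also have "\<dots> = (2 * (r * s) * e)\<^sup>2 * (r * (1 + s))"
    unfolding power_mult_distrib[of _ e] power_mult_distrib[of 2] rs by simp
  finally have m2: "m\<^sup>2 = r * (1 + s)" using nz \<open>e \<noteq> 0\<close> by simp
  define u where "u = m / t"
  have t0: "t \<noteq> 0" using t2 nz by auto
  have u2: "u\<^sup>2 = 1 + s" unfolding u_def using m2 t2 nz by (simp add: power_divide)
  have mtu: "m = t * u" using t0 by (simp add: u_def)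
  have "y\<^sup>2 = (t * (r * s) + u * e)\<^sup>2"
  proof -
    have "(t * (r * s) + u * e)\<^sup>2 = t\<^sup>2 * (r * s)\<^sup>2 + 2 * (r * s) * e * (t * u) + u\<^sup>2 * e\<^sup>2"
      by (simp add: algebra_simps power2_eq_square)
    also have "\<dots> = y\<^sup>2" unfolding mtu[symmetric] me t2 u2 rs by (simp add: algebra_simps)
    finally show ?thesis by simp
  qed
  then have "y = t * (r * s) + u * e \<or> y = (- t) * (r * s) + (- u) * e"
    unfolding power2_eq_iff by auto
  then obtain t' u' where t': "t'\<^sup>2 = r" and u': "u'\<^sup>2 = 1 + s" and tu: "m = t' * u'"
    and yt: "y = t' * (r * s) + u' * e"
    using t2 u2 mtu by (metis minus_mult_minus power2_minus)
  have t'0: "t' \<noteq> 0" using t' nz by auto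
  have u'm: "u' = m / t'" using tu t'0 by simp
  \<comment> \<open>\<open>t'\<close> is rational over \<open>y\<close>, \<open>r\<close> and \<open>m\<close>\<close>
  have yr: "y * r = t' * (r * r * s + m * e)"
    unfolding yt tu t'[symmetric] by (simp add: algebra_simps power2_eq_square)
  have y0: "r * r * s + m * e \<noteq> 0"
  proof
    assume "r * r * s + m * e = 0"
    then have "m * e = - (r\<^sup>2 * s)" by (simp add: add_eq_0_iff power2_eq_square)
    also have "\<dots> = - 2" unfolding r using s by (simp add: power2_eq_square)
    finally have eq: "m * e = - 2" .
    then have "m\<^sup>2 * e\<^sup>2 = 4" by (simp flip: power_mult_distrib)
    then have E: "r * (1 + s) * (r + j)\<^sup>2 * (1 - z)\<^sup>2 = 4"
      unfolding m2 e_def by (simp add: power_mult_distrib mult_ac)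
    \<comment> \<open>eliminating \<open>r\<close> and then \<open>s\<close> leaves a rational value for \<open>j\<close>\<close>
    have "4 * (1 - z)\<^sup>2 = (2 - 2 * z)\<^sup>2" by Groebner_Basis.algebra
    then have "4 * (1 - z)\<^sup>2 = 4 * ((1 - j) * (1 - s))"
      unfolding z2 using j s by Groebner_Basis.algebra
    then have "(1 - z)\<^sup>2 = (1 - j) * (1 - s)" by simp
    then have E1: "r * (1 + s) * (r + j)\<^sup>2 * ((1 - j) * (1 - s)) = 4" using E by simp
    have E2: "r * ((1 - j) * (1 - s)) = 4 + 2 * (1 + j) * s"
      using j s r E1 by Groebner_Basis.algebra
    have E3: "(16 + 22 * j) * s = - (16 + 8 * j)" using j s r E2 by Groebner_Basis.algebra
    have "1152 * j = 648" using j s E3 by Groebner_Basis.algebra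
    then have "(1152 * j)\<^sup>2 = 648\<^sup>2" by (rule arg_cong)
    with j show False by (simp add: power_mult_distrib)
  qed
  then have "t' = y * r / (r * r * s + m * e)" using yr by (simp add: field_simps)
  then have tF: "t' \<in> ?F" using yF rF sF mF eF by (simp only:) (intro rat_adjoin_closed)
  then have uF: "u' \<in> ?F" unfolding u'm using mF by (intro rat_adjoin_closed)
  have s4: "t' ^ 4 = s" unfolding power_as_squares t' r ..
  have T: "j\<^sup>2 = - 1" "t' ^ 8 = 2" "u'\<^sup>2 = 1 + t' ^ 4"
    using j s u' s4 unfolding power_as_squares t' r by simp_all
  have R: "\<i>\<^sup>2 = - 1" "rt8 ^ 8 = 2" "unit_rt\<^sup>2 = 1 + rt8 ^ 4"
    by (simp_all add: rt8_power rt_squares)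
  have 1: "\<i> \<in> ?F \<and> rt8 \<in> ?F \<and> unit_rt \<in> ?F"
    by (rule tower8_mem[OF T R jF tF uF])
  let ?K = "rat_adjoin {\<i>, rt8, unit_rt}"
  have K: "j \<in> ?K \<and> t' \<in> ?K \<and> u' \<in> ?K"
    by (rule tower8_mem[OF R T]) (auto intro: rat_adjoin_incl)
  then have jK: "j \<in> ?K" and tK: "t' \<in> ?K" and uK: "u' \<in> ?K" by auto
  have rK: "r \<in> ?K" and sK: "s \<in> ?K"
    unfolding s4[symmetric] t'[symmetric] using tK by (auto intro: rat_adjoin_power)
  have zK: "z \<in> ?K" unfolding z_def using sK jK by (intro rat_adjoin_closed)
  have "y \<in> ?K" unfolding yt e_def using jK tK uK rK sK zK by (intro rat_adjoin_closed)
  moreover have x: "x = (y - 1 - z) / 2" unfolding y_def by simp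
  ultimately have "x \<in> ?K" unfolding x using zK by (intro rat_adjoin_closed)
  with 1 show ?thesis by (intro rat_adjoin_eqI) auto
qed

section \<open>Torsion points and twisting\<close>

lemma ec_mult_Infty [simp]: "ec_mult a n Infty = Infty"
  by (induction n) (simp_all add: ec_mult_def)

lemma ec_torsion_1: "ec_torsion a b UNIV 1 = {Infty}"
  by (auto simp: ec_torsion_def ec_mult_def)

lemma ec_torsion_double:
  fixes a :: "'a::field_char_0"
  assumes "4 * a ^ 3 + 27 * b\<^sup>2 \<noteq> 0"
  shows "P \<in> ec_torsion a b UNIV (2 * n) \<longleftrightarrow>
    P \<in> ec_points a b UNIV \<and> ec_add a P P \<in> ec_torsion a b UNIV n"
  using ec_mult_double[OF _ assms, of P n] ec_add_closed[of P a b P]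
  by (auto simp: ec_torsion_def)

text \<open>The isomorphism from \<open>y\<^sup>2 = x\<^sup>3 + a x + b\<close> to \<open>y\<^sup>2 = x\<^sup>3 + a c\<^sup>4 x + b c\<^sup>6\<close>.\<close>

fun ec_scale :: "'a::field \<Rightarrow> 'a ec_point \<Rightarrow> 'a ec_point" where
  "ec_scale c Infty = Infty"
| "ec_scale c (Affine x y) = Affine (c\<^sup>2 * x) (c ^ 3 * y)"

lemma ec_scale_add:
  assumes c: "c \<noteq> (0::'a::field_char_0)"
  shows "ec_add (a * c ^ 4) (ec_scale c P) (ec_scale c Q) = ec_scale c (ec_add a P Q)"
proof (cases P; cases Q)
  fix x1 y1 x2 y2
  assume PQ: "P = Affine x1 y1" "Q = Affine x2 y2"
  define m where "m = (if x1 = x2 then (3 * x1\<^sup>2 + a) / (2 * y1) else (y2 - y1) / (x2 - x1))"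
  have "c ^ 3 * y1 = - (c ^ 3 * y2) \<longleftrightarrow> c ^ 3 * y1 = c ^ 3 * (- y2)" by simp
  then have eq: "c\<^sup>2 * x1 = c\<^sup>2 * x2 \<longleftrightarrow> x1 = x2" "c ^ 3 * y1 = - (c ^ 3 * y2) \<longleftrightarrow> y1 = - y2"
    using c by (simp_all only: mult_left_cancel[OF power_not_zero[OF c]])
  have "(3 * (c\<^sup>2 * x1)\<^sup>2 + a * c ^ 4) / (2 * (c ^ 3 * y1)) = c * ((3 * x1\<^sup>2 + a) / (2 * y1))"
  proof -
    have "3 * (c\<^sup>2 * x1)\<^sup>2 + a * c ^ 4 = c ^ 3 * (c * (3 * x1\<^sup>2 + a))"
      by (simp add: algebra_simps eval_nat_numeral)
    moreover have "2 * (c ^ 3 * y1) = c ^ 3 * (2 * y1)" by simp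
    ultimately show ?thesis using c by (simp only: mult_divide_mult_cancel_left[OF power_not_zero[OF c]] times_divide_eq_right)
  qed
  moreover have "(c ^ 3 * y2 - c ^ 3 * y1) / (c\<^sup>2 * x2 - c\<^sup>2 * x1) = c * ((y2 - y1) / (x2 - x1))"
  proof -
    have "c ^ 3 * y2 - c ^ 3 * y1 = c\<^sup>2 * (c * (y2 - y1))"
      by (simp add: algebra_simps eval_nat_numeral)
    moreover have "c\<^sup>2 * x2 - c\<^sup>2 * x1 = c\<^sup>2 * (x2 - x1)" by (simp add: algebra_simps)
    ultimately show ?thesis using c by (simp only: mult_divide_mult_cancel_left[OF power_not_zero[OF c]] times_divide_eq_right)
  qed
  ultimately have m: "(if x1 = x2 then (3 * (c\<^sup>2 * x1)\<^sup>2 + a * c ^ 4) / (2 * (c ^ 3 * y1))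
      else (c ^ 3 * y2 - c ^ 3 * y1) / (c\<^sup>2 * x2 - c\<^sup>2 * x1)) = c * m"
    by (simp only: m_def if_distrib[of "times c"])
  show ?thesis
  proof (cases "x1 = x2 \<and> y1 = - y2")
    case True
    then show ?thesis using PQ by simp
  next
    case False
    have "ec_add (a * c ^ 4) (ec_scale c P) (ec_scale c Q) =
      Affine ((c * m)\<^sup>2 - c\<^sup>2 * x1 - c\<^sup>2 * x2)
        (c * m * (c\<^sup>2 * x1 - ((c * m)\<^sup>2 - c\<^sup>2 * x1 - c\<^sup>2 * x2)) - c ^ 3 * y1)"
      unfolding PQ ec_scale.simps ec_add.simps eq m Let_def using False by (simp only: if_False)
    also have "\<dots> = ec_scale c (Affine (m\<^sup>2 - x1 - x2) (m * (x1 - (m\<^sup>2 - x1 - x2)) - y1))"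
      by (simp add: algebra_simps eval_nat_numeral)
    also have "Affine (m\<^sup>2 - x1 - x2) (m * (x1 - (m\<^sup>2 - x1 - x2)) - y1) = ec_add a P Q"
      unfolding PQ ec_add.simps m_def Let_def using False by (simp only: if_False)
    finally show ?thesis .
  qed
qed auto

lemma ec_scale_mult:
  assumes "c \<noteq> (0::'a::field_char_0)"
  shows "ec_mult (a * c ^ 4) n (ec_scale c P) = ec_scale c (ec_mult a n P)"
  by (induction n) (simp_all add: ec_mult_def ec_scale_add[OF assms])

lemma ec_scale_points:
  fixes c :: "'a::field_char_0"
  assumes c: "c \<noteq> 0"
  shows "ec_points (a * c ^ 4) (b * c ^ 6) UNIV = ec_scale c ` ec_points a b UNIV"
proof
  have curve: "(c ^ 3 * y)\<^sup>2 = (c\<^sup>2 * x) ^ 3 + a * c ^ 4 * (c\<^sup>2 * x) + b * c ^ 6 \<longleftrightarrow>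
      y\<^sup>2 = x ^ 3 + a * x + b" for x y
  proof -
    have "(c ^ 3 * y)\<^sup>2 = c ^ 6 * y\<^sup>2"
      "(c\<^sup>2 * x) ^ 3 + a * c ^ 4 * (c\<^sup>2 * x) + b * c ^ 6 = c ^ 6 * (x ^ 3 + a * x + b)"
      by (simp_all add: algebra_simps eval_nat_numeral)
    then show ?thesis using mult_left_cancel[OF power_not_zero[OF c], of 6] by simp
  qed
  show "ec_scale c ` ec_points a b UNIV \<subseteq> ec_points (a * c ^ 4) (b * c ^ 6) UNIV"
  proof (rule image_subsetI)
    fix P assume "P \<in> ec_points a b UNIV"
    then show "ec_scale c P \<in> ec_points (a * c ^ 4) (b * c ^ 6) UNIV"
      by (cases P) (simp_all only: ec_scale.simps ec_points_Affine ec_points_Infty curve)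
  qed
  show "ec_points (a * c ^ 4) (b * c ^ 6) UNIV \<subseteq> ec_scale c ` ec_points a b UNIV"
  proof
    fix P assume P: "P \<in> ec_points (a * c ^ 4) (b * c ^ 6) UNIV"
    show "P \<in> ec_scale c ` ec_points a b UNIV"
    proof (cases P)
      case Infty
      then show ?thesis by (intro image_eqI[of _ _ Infty]) simp_all
    next
      case (Affine x y)
      have "P = ec_scale c (Affine (x / c\<^sup>2) (y / c ^ 3))" using Affine c by simp
      moreover from this have "Affine (x / c\<^sup>2) (y / c ^ 3) \<in> ec_points a b UNIV"
        using P by (simp only: ec_scale.simps ec_points_Affine curve)
      ultimately show ?thesis by blast
    qed
  qed
qed

lemma ec_scale_torsion:
  assumes "c \<noteq> (0::'a::field_char_0)"
  shows "ec_torsion (a * c ^ 4) (b * c ^ 6) UNIV n = ec_scale c ` ec_torsion a b UNIV n"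
proof -
  have "ec_scale c P = Infty \<longleftrightarrow> P = Infty" for P by (cases P) auto
  then show ?thesis
    unfolding ec_torsion_def ec_scale_points[OF assms] using ec_scale_mult[OF assms] by auto
qed

lemma torsion_field_eq_scale:
  assumes d: "d \<noteq> 0"
    and alg: "\<And>P. P \<in> ec_torsion (- 11) 14 UNIV n \<Longrightarrow>
      ec_coords (ec_scale (csqrt (of_int d)) P) \<subseteq> algebraic_numbers"
  shows "torsion_field (E_a d) (E_b d) n =
    rat_adjoin (\<Union>P \<in> ec_torsion (- 11) 14 UNIV n. ec_coords (ec_scale (csqrt (of_int d)) P))"
proof -
  let ?c = "csqrt (of_int d)"
  have c: "?c \<noteq> 0" using d by simp
  have "?c ^ 4 = (?c\<^sup>2)\<^sup>2" "?c ^ 6 = (?c\<^sup>2) ^ 3" by (simp_all only: flip: power_mult) simp_all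
  then have E: "E_a d = - 11 * ?c ^ 4" "E_b d = 14 * ?c ^ 6"
    by (simp_all add: E_a_def E_b_def)
  have "ec_torsion (E_a d) (E_b d) algebraic_numbers n =
      {P \<in> ec_torsion (E_a d) (E_b d) UNIV n. ec_coords P \<subseteq> algebraic_numbers}"
    by (auto simp: ec_torsion_def ec_points_def)
  also have "\<dots> = ec_scale ?c ` ec_torsion (- 11) 14 UNIV n"
    unfolding E ec_scale_torsion[OF c] using alg by blast
  finally show ?thesis unfolding torsion_field_def by simp
qed

section \<open>Halving over a subfield of the complex numbers\<close>

text \<open>Squares of elements of a set \<open>F\<close> of complex numbers.\<close>

definition square_in :: "complex set \<Rightarrow> complex \<Rightarrow> bool" where
  "square_in F w \<longleftrightarrow> (\<exists>v \<in> F. w = v\<^sup>2)"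

lemma square_in_mult:
  "square_in (rat_adjoin S) v \<Longrightarrow> square_in (rat_adjoin S) w \<Longrightarrow> square_in (rat_adjoin S) (v * w)"
  unfolding square_in_def by (metis power_mult_distrib rat_adjoin_mult)

lemma square_in_root:
  assumes "square_in (rat_adjoin S) w" "g\<^sup>2 = w"
  shows "g \<in> rat_adjoin S"
proof -
  obtain v where "v \<in> rat_adjoin S" "g\<^sup>2 = v\<^sup>2" using assms by (auto simp: square_in_def)
  then show ?thesis unfolding power2_eq_iff by (auto intro: rat_adjoin_uminus)
qed

locale complex_split_curve = split_curve a b e1 e2 e3 for a b e1 e2 e3 :: complex
begin

text \<open>The halves of a point are defined over a field that contains \<open>x0\<close> and the square roots of \<open>x0 - ei\<close>.\<close>

lemma half_coords:
  assumes P: "P \<in> ec_points a b UNIV" and D: "ec_add a P P = Affine x0 y0"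
    and x0: "x0 \<in> rat_adjoin S"
    and sq: "square_in (rat_adjoin S) (x0 - e1)" "square_in (rat_adjoin S) (x0 - e2)"
      "square_in (rat_adjoin S) (x0 - e3)"
  shows "ec_coords P \<subseteq> rat_adjoin S"
proof (cases P)
  case (Affine x y)
  obtain g1 g2 g3 where g: "g1\<^sup>2 = x0 - e1" "g2\<^sup>2 = x0 - e2" "g3\<^sup>2 = x0 - e3"
    and h: "Affine x y = half_point x0 g1 g2 g3"
    using double_imp_half_point[of x y x0 y0] P D unfolding Affine by metis
  note gF = square_in_root[OF sq(1) g(1)] square_in_root[OF sq(2) g(2)] square_in_root[OF sq(3) g(3)]
  show ?thesis unfolding Affine h half_point_def
    using gF x0 by (auto intro!: rat_adjoin_add rat_adjoin_mult)
qed simp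

text \<open>Conversely, the coordinates of a single half generate these square roots over the roots \<open>ei\<close>.\<close>

lemma coords_half_square:
  assumes P: "P \<in> ec_points a b UNIV" and D: "ec_add a P P = Affine x0 y0"
    and PF: "ec_coords P \<subseteq> rat_adjoin S"
    and e: "e1 \<in> rat_adjoin S" "e2 \<in> rat_adjoin S" "e3 \<in> rat_adjoin S"
    and g: "g\<^sup>2 = x0 - e1 \<or> g\<^sup>2 = x0 - e2 \<or> g\<^sup>2 = x0 - e3"
  shows "g \<in> rat_adjoin S"
proof -
  obtain x y where xy: "P = Affine x y" using D by (cases P) auto
  let ?F = "rat_adjoin S"
  have F: "x \<in> ?F" "y \<in> ?F" using PF xy by auto
  obtain g1 g2 g3 where g': "g1\<^sup>2 = x0 - e1" "g2\<^sup>2 = x0 - e2" "g3\<^sup>2 = x0 - e3"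
    and s: "g2 + g3 = y / (x - e1)" "g1 + g3 = y / (x - e2)" "g1 + g2 = y / (x - e3)"
    using double_imp_half_point[of x y x0 y0] P D unfolding xy by metis
  have "g2 + g3 \<in> ?F" "g1 + g3 \<in> ?F" "g1 + g2 \<in> ?F"
    unfolding s using F e by (auto intro!: rat_adjoin_divide rat_adjoin_diff)
  moreover have "g1 = ((g1 + g2) + (g1 + g3) - (g2 + g3)) / 2"
    "g2 = ((g1 + g2) + (g2 + g3) - (g1 + g3)) / 2" "g3 = ((g1 + g3) + (g2 + g3) - (g1 + g2)) / 2"
    by simp_all
  ultimately have "g1 \<in> ?F" "g2 \<in> ?F" "g3 \<in> ?F"
    by (metis rat_adjoin_add rat_adjoin_diff rat_adjoin_divide rat_adjoin_numeral)+
  moreover have "g\<^sup>2 = g1\<^sup>2 \<or> g\<^sup>2 = g2\<^sup>2 \<or> g\<^sup>2 = g3\<^sup>2" using g g' by metis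
  ultimately show ?thesis unfolding power2_eq_iff by (auto intro: rat_adjoin_uminus)
qed

end

section \<open>The curve \<open>y\<^sup>2 = x\<^sup>3 - 11 x + 14\<close>\<close>

text \<open>The two irrational roots; the third one is \<open>2\<close>.\<close>

definition e2 :: complex where "e2 = - 1 + 2 * rt2"
definition e3 :: complex where "e3 = - 1 - 2 * rt2"

abbreviation E_points :: "complex ec_point set" where
  "E_points \<equiv> ec_points (- 11) 14 UNIV"

abbreviation E_torsion :: "nat \<Rightarrow> complex ec_point set" where
  "E_torsion \<equiv> ec_torsion (- 11) 14 UNIV"

abbreviation E_double :: "complex ec_point \<Rightarrow> complex ec_point" where
  "E_double P \<equiv> ec_add (- 11) P P"

lemma rt2_mult: "rt2 * rt2 = 2" "rt2 * (rt2 * x) = 2 * x"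
  using rt_squares(1) by (simp_all add: power2_eq_square flip: mult.assoc)

lemma rt4_mult: "rt4 * rt4 = rt2" "rt4 * (rt4 * x) = rt2 * x"
  using rt_squares(2) by (simp_all add: power2_eq_square flip: mult.assoc)

lemma rt8_mult: "rt8 * rt8 = rt4" "rt8 * (rt8 * x) = rt4 * x"
  using rt_squares(3) by (simp_all add: power2_eq_square flip: mult.assoc)

lemma unit_rt_mult: "unit_rt * unit_rt = 1 + rt2" "unit_rt * (unit_rt * x) = (1 + rt2) * x"
  using rt_squares(4) by (simp_all add: power2_eq_square flip: mult.assoc)

lemma ii_mult: "\<i> * (\<i> * x) = - x"
  by (simp flip: mult.assoc)

lemmas rt_mult = rt2_mult rt4_mult rt8_mult unit_rt_mult ii_mult

lemma rt_nonzero: "rt2 \<noteq> 0" "rt4 \<noteq> 0" "rt8 \<noteq> 0" "unit_rt \<noteq> 0" "1 + rt2 \<noteq> 0" "rt2 - 1 \<noteq> 0"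
proof -
  show 2: "rt2 \<noteq> 0" and 4: "rt4 \<noteq> 0" and 8: "rt8 \<noteq> 0" using rt_squares by auto
  have "(rt2 - 1) * (1 + rt2) = 1" by (simp add: algebra_simps rt_mult)
  then show n: "1 + rt2 \<noteq> 0" "rt2 - 1 \<noteq> 0" by auto
  then show "unit_rt \<noteq> 0" using rt_squares(4) by auto
qed

interpretation E: complex_split_curve "- 11" 14 2 e2 e3
proof
  show "2 + e2 + e3 = 0" by (simp add: e2_def e3_def)
  show "- 11 = 2 * e2 + 2 * e3 + e2 * e3" "14 = - (2 * e2 * e3)"
    by (simp_all add: e2_def e3_def algebra_simps rt_mult)
  have d: "2 - e2 = (rt2 - 1)\<^sup>2" "2 - e3 = (1 + rt2)\<^sup>2" "e2 - e3 = 4 * rt2"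
    by (simp_all add: e2_def e3_def algebra_simps power2_eq_square rt_mult)
  then have "2 - e2 \<noteq> 0" "2 - e3 \<noteq> 0" "e2 - e3 \<noteq> 0" using rt_nonzero by simp_all
  then show "2 \<noteq> e2" "2 \<noteq> e3" "e2 \<noteq> e3" by auto
qed

text \<open>Square roots of the differences of the roots.\<close>

lemma root_differences:
  "2 - e2 = (rt2 - 1)\<^sup>2" "2 - e3 = (1 + rt2)\<^sup>2"
  "e2 - 2 = (\<i> * (rt2 - 1))\<^sup>2" "e2 - e3 = (2 * rt4)\<^sup>2"
  "e3 - 2 = (\<i> * (1 + rt2))\<^sup>2" "e3 - e2 = (2 * \<i> * rt4)\<^sup>2"
  by (simp_all add: e2_def e3_def algebra_simps power2_eq_square rt_mult)

lemma E_nonsing: "4 * (- 11 :: complex) ^ 3 + 27 * 14\<^sup>2 \<noteq> 0"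
  by simp

lemma E_torsion_2: "E_torsion 2 = {Infty, Affine 2 0, Affine e2 0, Affine e3 0}"
proof -
  have "P \<in> E_torsion 2 \<longleftrightarrow> P \<in> E_points \<and> E_double P = Infty" for P
    using ec_torsion_double[OF E_nonsing, of P 1, unfolded ec_torsion_1] by simp
  then show ?thesis using E.double_eq_Infty_iff E.two_torsion_on_curve by auto
qed

lemma E_torsion_4: "P \<in> E_torsion 4 \<longleftrightarrow> P \<in> E_points \<and> E_double P \<in> E_torsion 2"
  using ec_torsion_double[OF E_nonsing, of P 2] by simp

lemma E_torsion_8: "P \<in> E_torsion 8 \<longleftrightarrow> P \<in> E_points \<and> E_double P \<in> E_torsion 4"
  using ec_torsion_double[OF E_nonsing, of P 4] by simp

lemma Infty_E_torsion: "Infty \<in> E_torsion n"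
  by (simp add: ec_torsion_def)

lemma E_torsion_2_subset_4: "E_torsion 2 \<subseteq> E_torsion 4"
proof
  fix P assume "P \<in> E_torsion 2"
  then have "P \<in> E_points" "E_double P = Infty"
    using E_torsion_2 E.double_eq_Infty_iff E.two_torsion_on_curve by auto
  then show "P \<in> E_torsion 4" using E_torsion_4 Infty_E_torsion by simp
qed

lemma E_torsion_4_subset_8: "E_torsion 4 \<subseteq> E_torsion 8"
  using E_torsion_4 E_torsion_8 E_torsion_2_subset_4 by blast

subsection \<open>The torsion points are defined over the tower\<close>

text \<open>Generators of the fields of the 4-torsion and of the 8-torsion.\<close>

abbreviation K4 :: "complex set" where "K4 \<equiv> {\<i>, rt4}"
abbreviation K8 :: "complex set" where "K8 \<equiv> {\<i>, rt8, unit_rt}"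

lemma rt2_mem:
  "rt4 \<in> rat_adjoin S \<Longrightarrow> rt2 \<in> rat_adjoin S"
  using rat_adjoin_power[of rt4 S 2] rt_squares by simp

lemma rt4_mem:
  "rt8 \<in> rat_adjoin S \<Longrightarrow> rt4 \<in> rat_adjoin S"
  using rat_adjoin_power[of rt8 S 2] rt_squares by simp

lemma root_mem:
  assumes "rt2 \<in> rat_adjoin S"
  shows "e2 \<in> rat_adjoin S" "e3 \<in> rat_adjoin S"
  unfolding e2_def e3_def using assms by (auto intro!: rat_adjoin_closed)

lemma root_mem_rt2:
  assumes "e2 \<in> rat_adjoin S"
  shows "rt2 \<in> rat_adjoin S"
proof -
  have "rt2 = (e2 + 1) / 2" by (simp add: e2_def)
  also have "\<dots> \<in> rat_adjoin S" using assms by (intro rat_adjoin_closed)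
  finally show ?thesis .
qed

lemma E_torsion_2_coords:
  assumes "rt2 \<in> rat_adjoin S" "P \<in> E_torsion 2"
  shows "ec_coords P \<subseteq> rat_adjoin S"
  using assms root_mem[OF assms(1)] by (auto simp: E_torsion_2)

lemma E_torsion_4_coords:
  assumes "\<i> \<in> rat_adjoin S" "rt4 \<in> rat_adjoin S" and P: "P \<in> E_torsion 4"
  shows "ec_coords P \<subseteq> rat_adjoin S"
proof -
  note rt2 = rt2_mem[OF assms(2)]
  note e = root_mem[OF rt2]
  have P: "P \<in> E_points" and D: "E_double P \<in> {Infty, Affine 2 0, Affine e2 0, Affine e3 0}"
    using P E_torsion_4 E_torsion_2 by auto
  have sqI: "square_in (rat_adjoin S) (v\<^sup>2)" if "v \<in> rat_adjoin S" for v
    using that by (auto simp: square_in_def)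
  have sq: "square_in (rat_adjoin S) (2 - e2)" "square_in (rat_adjoin S) (2 - e3)"
    "square_in (rat_adjoin S) (e2 - 2)" "square_in (rat_adjoin S) (e2 - e3)"
    "square_in (rat_adjoin S) (e3 - 2)" "square_in (rat_adjoin S) (e3 - e2)"
    unfolding root_differences
    by (intro sqI rat_adjoin_closed assms(1,2) rt2)+
  have sq0: "square_in (rat_adjoin S) 0" using sqI[of 0] by simp
  from D consider "E_double P = Infty" | "E_double P = Affine 2 0" | "E_double P = Affine e2 0"
    | "E_double P = Affine e3 0" by blast
  then show ?thesis
  proof cases
    case 1
    then have "P \<in> E_torsion 2" using P E_torsion_2 E.double_eq_Infty_iff by auto
    then show ?thesis using E_torsion_2_coords rt2 by blast
  next
    case 2
    show ?thesis by (rule E.half_coords[OF P 2]) (simp_all add: sq sq0)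
  next
    case 3
    show ?thesis by (rule E.half_coords[OF P 3 e(1)]) (simp_all add: sq sq0)
  next
    case 4
    show ?thesis by (rule E.half_coords[OF P 4 e(2)]) (simp_all add: sq sq0)
  qed
qed

text \<open>
  A half \<open>(x0, y0)\<close> of the point \<open>(e, 0)\<close> of order two is given by square roots \<open>g\<close> and \<open>h\<close> of
  the differences of \<open>e\<close> and the other two roots, and its distances from the roots are \<open>g h\<close>,
  \<open>g (g + h)\<close> and \<open>h (g + h)\<close>.  In the field generated by \<open>\<i>\<close>, \<open>rt8\<close> and \<open>unit_rt\<close> the numbers
  \<open>g\<close>, \<open>h\<close> and \<open>g + h\<close> are squares.
\<close>

lemma quarter_point_squares:
  assumes i: "\<i> \<in> rat_adjoin S" and t: "rt8 \<in> rat_adjoin S" and u: "unit_rt \<in> rat_adjoin S"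
    and P: "Affine x0 y0 \<in> E_points"
    and D: "E_double (Affine x0 y0) = Affine e 0" and e: "e \<in> {2, e2, e3}"
  shows "square_in (rat_adjoin S) (x0 - 2) \<and> square_in (rat_adjoin S) (x0 - e2) \<and>
    square_in (rat_adjoin S) (x0 - e3)"
proof -
  let ?sq = "square_in (rat_adjoin S)"
  note r = rt4_mem[OF t]
  note s = rt2_mem[OF r]
  have sqI: "?sq w" if "v \<in> rat_adjoin S" "v\<^sup>2 = w" for v w
    using that by (auto simp: square_in_def)
  have i': "?sq \<i>"
  proof (rule sqI)
    show "(1 + \<i>) / rt2 \<in> rat_adjoin S" using i s by (intro rat_adjoin_closed)
    show "((1 + \<i>) / rt2)\<^sup>2 = \<i>"
      unfolding power_divide rt_squares by (simp add: power2_sum)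
  qed
  have m1: "?sq (- 1)" using i by (intro sqI[of \<i>]) simp_all
  have sq2: "?sq 2" using s by (intro sqI[of rt2]) (simp_all add: rt_squares)
  have sqs: "?sq rt2" using r by (intro sqI[of rt4]) (simp_all add: rt_squares)
  have sqr: "?sq rt4" using t by (intro sqI[of rt8]) (simp_all add: rt_squares)
  have sp: "?sq (1 + rt2)" using u by (intro sqI[of unit_rt]) (simp_all add: rt_squares)
  have sm: "?sq (rt2 - 1)"
  proof (rule sqI)
    show "1 / unit_rt \<in> rat_adjoin S" using u by (intro rat_adjoin_closed)
    have "(rt2 - 1) * (1 + rt2) = 1" by (simp add: algebra_simps rt_mult)
    then show "(1 / unit_rt)\<^sup>2 = rt2 - 1"
      unfolding power_divide rt_squares using rt_nonzero(5) by (simp add: field_simps)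
  qed
  have neg: "?sq (- w)" if "?sq w" for w
    using square_in_mult[OF m1 that] by simp
  have pm: "?sq g" if "g = h \<or> g = - h" "?sq h" for g h
    using that neg by auto
  note mult = square_in_mult[of S]
  have sq_2r: "?sq (2 * rt4)" and sq_2ir: "?sq (2 * \<i> * rt4)" and sq_2s: "?sq (2 * rt2)"
    and sq_im: "?sq (\<i> * (rt2 - 1))" and sq_ip: "?sq (\<i> * (1 + rt2))"
    by (intro mult sq2 sqr sqs i' sm sp)+
  have sq_i: "?sq (\<i> * v\<^sup>2)" if "v \<in> rat_adjoin S" for v
    by (intro mult i' sqI[OF that refl])
  have sum2: "?sq (\<i> * (rt2 - 1) + 2 * rt4)" "?sq (\<i> * (rt2 - 1) - 2 * rt4)"
  proof -
    have "\<i> * (rt2 - 1) + 2 * rt4 = - (\<i> * (1 + \<i> * rt4)\<^sup>2)"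
      "\<i> * (rt2 - 1) - 2 * rt4 = - (\<i> * (1 - \<i> * rt4)\<^sup>2)"
      by (simp_all add: algebra_simps power2_eq_square rt_mult)
    then show "?sq (\<i> * (rt2 - 1) + 2 * rt4)" "?sq (\<i> * (rt2 - 1) - 2 * rt4)"
      using neg[OF sq_i[of "1 + \<i> * rt4"]] neg[OF sq_i[of "1 - \<i> * rt4"]] i r
      by (auto intro!: rat_adjoin_closed)
  qed
  have sum3: "?sq (\<i> * (1 + rt2) + 2 * \<i> * rt4)" "?sq (\<i> * (1 + rt2) - 2 * \<i> * rt4)"
  proof -
    have "\<i> * (1 + rt2) + 2 * \<i> * rt4 = \<i> * (1 + rt4)\<^sup>2"
      "\<i> * (1 + rt2) - 2 * \<i> * rt4 = \<i> * (1 - rt4)\<^sup>2"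
      by (simp_all add: algebra_simps power2_eq_square rt_mult)
    then show "?sq (\<i> * (1 + rt2) + 2 * \<i> * rt4)" "?sq (\<i> * (1 + rt2) - 2 * \<i> * rt4)"
      using sq_i[of "1 + rt4"] sq_i[of "1 - rt4"] r by (auto intro!: rat_adjoin_closed)
  qed
  have sum_pm: "?sq (g + h)" if "g = v \<or> g = - v" "h = w \<or> h = - w" "?sq (v + w)" "?sq (v - w)"
    for g h v w
  proof -
    have "g + h \<in> {v + w, v - w, - (v + w), - (v - w)}" using that(1,2) by auto
    then show ?thesis using that(3,4) neg[OF that(3)] neg[OF that(4)] by auto
  qed
  obtain g1 g2 g3 where g: "g1\<^sup>2 = e - 2" "g2\<^sup>2 = e - e2" "g3\<^sup>2 = e - e3"
    and h: "Affine x0 y0 = half_point e g1 g2 g3"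
    using E.double_imp_half_point[OF P D] by metis
  have x0: "x0 = e + g1 * g2 + g1 * g3 + g2 * g3" using h by (simp add: half_point_def)
  have gg: "x0 - 2 = g1\<^sup>2 + g1 * g2 + g1 * g3 + g2 * g3"
    "x0 - e2 = g2\<^sup>2 + g1 * g2 + g1 * g3 + g2 * g3"
    "x0 - e3 = g3\<^sup>2 + g1 * g2 + g1 * g3 + g2 * g3" unfolding g x0 by simp_all
  consider "e = 2" | "e = e2" | "e = e3" using e by blast
  then show ?thesis
  proof cases
    case 1
    have g1: "g1 = 0" using g(1) 1 by simp
    have x: "x0 - 2 = g2 * g3" "x0 - e2 = g2 * (g2 + g3)" "x0 - e3 = g3 * (g2 + g3)"
      unfolding gg g1 by (simp_all add: algebra_simps power2_eq_square)
    have pm23: "g2 = rt2 - 1 \<or> g2 = - (rt2 - 1)" "g3 = 1 + rt2 \<or> g3 = - (1 + rt2)"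
      using g(2,3) unfolding 1 root_differences power2_eq_iff by auto
    have "?sq g2" "?sq g3" "?sq (g2 + g3)"
      using pm[OF pm23(1) sm] pm[OF pm23(2) sp] sum_pm[OF pm23] sq_2s neg[OF sq2] by simp_all
    then show ?thesis unfolding x by (simp add: square_in_mult)
  next
    case 2
    have g2: "g2 = 0" using g(2) 2 by simp
    have x: "x0 - 2 = g1 * (g1 + g3)" "x0 - e2 = g1 * g3" "x0 - e3 = g3 * (g1 + g3)"
      unfolding gg g2 by (simp_all add: algebra_simps power2_eq_square)
    have pm13: "g1 = \<i> * (rt2 - 1) \<or> g1 = - (\<i> * (rt2 - 1))" "g3 = 2 * rt4 \<or> g3 = - (2 * rt4)"
      using g(1,3) unfolding 2 root_differences power2_eq_iff by auto
    have "?sq g1" "?sq g3" "?sq (g1 + g3)"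
      using pm[OF pm13(1) sq_im] pm[OF pm13(2) sq_2r] sum_pm[OF pm13 sum2] by simp_all
    then show ?thesis unfolding x by (simp add: square_in_mult)
  next
    case 3
    have g3: "g3 = 0" using g(3) 3 by simp
    have x: "x0 - 2 = g1 * (g1 + g2)" "x0 - e2 = g2 * (g1 + g2)" "x0 - e3 = g1 * g2"
      unfolding gg g3 by (simp_all add: algebra_simps power2_eq_square)
    have pm12: "g1 = \<i> * (1 + rt2) \<or> g1 = - (\<i> * (1 + rt2))"
      "g2 = 2 * \<i> * rt4 \<or> g2 = - (2 * \<i> * rt4)"
      using g(1,2) unfolding 3 root_differences power2_eq_iff by auto
    have "?sq g1" "?sq g2" "?sq (g1 + g2)"
      using pm[OF pm12(1) sq_ip] pm[OF pm12(2) sq_2ir] sum_pm[OF pm12 sum3] by simp_all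
    then show ?thesis unfolding x by (simp add: square_in_mult)
  qed
qed

lemma E_torsion_8_coords:
  assumes i: "\<i> \<in> rat_adjoin S" and t: "rt8 \<in> rat_adjoin S" and u: "unit_rt \<in> rat_adjoin S"
    and P: "P \<in> E_torsion 8"
  shows "ec_coords P \<subseteq> rat_adjoin S"
proof (cases "P \<in> E_torsion 4")
  case True
  then show ?thesis using E_torsion_4_coords[OF i rt4_mem[OF t]] by blast
next
  case False
  have P: "P \<in> E_points" and D: "E_double P \<in> E_torsion 4" and D2: "E_double P \<notin> E_torsion 2"
    using P False E_torsion_8 E_torsion_4 by auto
  from D2 obtain x0 y0 where xy: "E_double P = Affine x0 y0"
    using Infty_E_torsion by (cases "E_double P") auto
  have Q: "Affine x0 y0 \<in> E_points" "E_double (Affine x0 y0) \<in> E_torsion 2"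
    using D E_torsion_4 unfolding xy by auto
  have "E_double (Affine x0 y0) \<noteq> Infty"
    using E.double_eq_Infty_iff[OF Q(1)] D2 unfolding xy E_torsion_2 by auto
  then obtain e where "E_double (Affine x0 y0) = Affine e 0" "e \<in> {2, e2, e3}"
    using Q(2) unfolding E_torsion_2 by blast
  from quarter_point_squares[OF i t u Q(1) this]
  have sq: "square_in (rat_adjoin S) (x0 - 2)" "square_in (rat_adjoin S) (x0 - e2)"
    "square_in (rat_adjoin S) (x0 - e3)" by auto
  have "x0 \<in> rat_adjoin S"
    using E_torsion_4_coords[OF i rt4_mem[OF t] D] unfolding xy by simp
  then show ?thesis by (rule E.half_coords[OF P xy _ sq])
qed

subsection \<open>The torsion points generate the tower\<close>

lemma point_1_2: "Affine 1 2 \<in> E_torsion 4" "E_double (Affine 1 2) = Affine 2 0"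
proof -
  show D: "E_double (Affine 1 2) = Affine 2 0"
    by (simp add: Let_def)
  then show "Affine 1 2 \<in> E_torsion 4"
    unfolding E_torsion_4 E_torsion_2 by (simp del: ec_add.simps)
qed

lemma E_torsion_4_generates:
  assumes "\<And>P. P \<in> E_torsion 4 \<Longrightarrow> ec_coords P \<subseteq> rat_adjoin S"
  shows "rt2 \<in> rat_adjoin S" "\<i> \<in> rat_adjoin S" "rt4 \<in> rat_adjoin S"
proof -
  have "Affine e2 0 \<in> E_torsion 4" using E_torsion_2 E_torsion_2_subset_4 by auto
  then show s: "rt2 \<in> rat_adjoin S" using assms root_mem_rt2 by fastforce
  note e = root_mem[OF s]
  \<comment> \<open>a half of \<open>(e2, 0)\<close>\<close>
  define P where "P = half_point e2 (\<i> * (rt2 - 1)) 0 (2 * rt4)"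
  have P: "P \<in> E_points" and D: "E_double P = Affine e2 0"
    using E.half_point_double[of "\<i> * (rt2 - 1)" e2 0 "2 * rt4"] root_differences
    unfolding P_def by (simp_all del: ec_add.simps)
  have "P \<in> E_torsion 4" using P D E_torsion_4 E_torsion_2 by simp
  then have F: "ec_coords P \<subseteq> rat_adjoin S" by (rule assms)
  have "\<i> * (rt2 - 1) \<in> rat_adjoin S"
    by (rule E.coords_half_square[OF P D F _ e]) (simp_all add: root_differences)
  then have "\<i> * (rt2 - 1) / (rt2 - 1) \<in> rat_adjoin S"
    using s by (intro rat_adjoin_divide rat_adjoin_diff rat_adjoin_one)
  then show "\<i> \<in> rat_adjoin S" using rt_nonzero by simp
  have "2 * rt4 \<in> rat_adjoin S"
    by (rule E.coords_half_square[OF P D F _ e]) (simp_all add: root_differences)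
  then have "2 * rt4 / 2 \<in> rat_adjoin S" by (intro rat_adjoin_divide rat_adjoin_numeral)
  then show "rt4 \<in> rat_adjoin S" by simp
qed

lemma E_torsion_8_generates:
  assumes "\<And>P. P \<in> E_torsion 8 \<Longrightarrow> ec_coords P \<subseteq> rat_adjoin S"
  shows "\<i> \<in> rat_adjoin S" "rt8 \<in> rat_adjoin S" "unit_rt \<in> rat_adjoin S"
proof -
  have "ec_coords P \<subseteq> rat_adjoin S" if "P \<in> E_torsion 4" for P
    using that assms E_torsion_4_subset_8 by blast
  note F4 = E_torsion_4_generates[OF this]
  show i: "\<i> \<in> rat_adjoin S" using F4 by blast
  have s: "rt2 \<in> rat_adjoin S" and r: "rt4 \<in> rat_adjoin S" using F4 by blast+
  note e = root_mem[OF s]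
  \<comment> \<open>a half of \<open>(1, 2)\<close>\<close>
  define P where "P = half_point 1 \<i> (- (\<i> * rt2 / unit_rt)) (rt2 * unit_rt)"
  have g: "\<i>\<^sup>2 = 1 - 2" "(- (\<i> * rt2 / unit_rt))\<^sup>2 = 1 - e2" "(rt2 * unit_rt)\<^sup>2 = 1 - e3"
  proof -
    have "(- (\<i> * rt2 / unit_rt))\<^sup>2 = - 2 / (1 + rt2)"
      by (simp add: power_divide power_mult_distrib rt_squares)
    also have "\<dots> = 1 - e2"
      using rt_nonzero(5) by (simp add: e2_def field_simps rt_mult)
    finally show "(- (\<i> * rt2 / unit_rt))\<^sup>2 = 1 - e2" .
  qed (simp_all add: power_mult_distrib rt_squares e3_def)
  have "\<i> * - (\<i> * rt2 / unit_rt) * (rt2 * unit_rt) = 2"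
    using rt_nonzero by (simp add: rt_mult)
  then have P: "P \<in> E_points" and D: "E_double P = Affine 1 2"
    using E.half_point_double[OF g] unfolding P_def by (simp_all only:)
  have "P \<in> E_torsion 8" using P D E_torsion_8 point_1_2 by simp
  then have F: "ec_coords P \<subseteq> rat_adjoin S" by (rule assms)
  have "rt2 * unit_rt \<in> rat_adjoin S"
    by (rule E.coords_half_square[OF P D F _ e]) (simp_all add: g)
  then have "rt2 * unit_rt / rt2 \<in> rat_adjoin S" using s by (intro rat_adjoin_divide)
  then show u: "unit_rt \<in> rat_adjoin S" using rt_nonzero by simp
  \<comment> \<open>a half \<open>Q\<close> of \<open>(e3, 0)\<close>, and a half \<open>R\<close> of \<open>Q\<close>\<close>
  define g1 g2 where "g1 = \<i> * (1 + rt2)" and "g2 = 2 * \<i> * rt4"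
  have g0: "g1 \<noteq> 0" "g2 \<noteq> 0" using rt_nonzero by (simp_all add: g1_def g2_def)
  have gsq: "g1\<^sup>2 = e3 - 2" "g2\<^sup>2 = e3 - e2" "0\<^sup>2 = e3 - e3"
    unfolding g1_def g2_def root_differences by simp_all
  define x0 where "x0 = e3 + g1 * g2"
  have Q: "Affine x0 ((g1 + g2) * (g1 * g2)) \<in> E_points"
    "E_double (Affine x0 ((g1 + g2) * (g1 * g2))) = Affine e3 0"
    using E.half_point_double[OF gsq] unfolding half_point_def x0_def
    by (simp_all add: mult.assoc del: ec_add.simps)
  have x0: "x0 - 2 = g1 * (g1 + g2)" "x0 - e2 = g2 * (g1 + g2)" "x0 - e3 = g1 * g2"
    using gsq unfolding x0_def by (simp_all add: algebra_simps power2_eq_square)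
  define h3 where "h3 = \<i> * rt2 * rt8 * unit_rt"
  define h2 where "h2 = csqrt (g2 * (g1 + g2))"
  define h1 where "h1 = (g1 + g2) * (g1 * g2) / (h2 * h3)"
  have h3: "h3\<^sup>2 = g1 * g2"
    unfolding h3_def g1_def g2_def by (simp add: power_mult_distrib rt_squares algebra_simps)
  have h2: "h2\<^sup>2 = g2 * (g1 + g2)" by (simp add: h2_def)
  have "g1 + g2 \<noteq> 0"
  proof
    assume "g1 + g2 = 0"
    then have "g1\<^sup>2 = g2\<^sup>2" by (simp add: add_eq_0_iff2 add_eq_0_iff)
    then show False using gsq E.distinct by simp
  qed
  then have n: "h2\<^sup>2 \<noteq> 0" "h3\<^sup>2 \<noteq> 0" using g0 h2 h3 by simp_all
  have "h1\<^sup>2 = ((g1 + g2) * (g1 * g2))\<^sup>2 / (h2\<^sup>2 * h3\<^sup>2)"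
    unfolding h1_def by (simp add: power_divide power_mult_distrib)
  also have "\<dots> = g1 * (g1 + g2)"
    unfolding h2 h3 using g0 \<open>g1 + g2 \<noteq> 0\<close> by (simp add: power2_eq_square)
  finally have h1: "h1\<^sup>2 = g1 * (g1 + g2)" .
  have h: "h1\<^sup>2 = x0 - 2" "h2\<^sup>2 = x0 - e2" "h3\<^sup>2 = x0 - e3"
    unfolding h1 h2 h3 x0 by simp_all
  define R where "R = half_point x0 h1 h2 h3"
  have "h1 * h2 * h3 = (g1 + g2) * (g1 * g2)" using n by (simp add: h1_def)
  then have R: "R \<in> E_points" "E_double R = Affine x0 ((g1 + g2) * (g1 * g2))"
    using E.half_point_double[OF h] unfolding R_def by (simp_all only:)
  have "R \<in> E_torsion 8"
    using R Q unfolding E_torsion_8 E_torsion_4 E_torsion_2 by (simp del: ec_add.simps)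
  then have F: "ec_coords R \<subseteq> rat_adjoin S" by (rule assms)
  have "h3 \<in> rat_adjoin S"
    by (rule E.coords_half_square[OF R F _ e]) (simp_all add: h)
  then have "h3 / (\<i> * rt2 * unit_rt) \<in> rat_adjoin S"
    using i s u by (intro rat_adjoin_closed)
  then show "rt8 \<in> rat_adjoin S" using rt_nonzero by (simp add: h3_def)
qed

section \<open>The torsion fields of the twists\<close>

lemma rat_adjoin_insert_cong:
  assumes "rat_adjoin S = rat_adjoin T"
  shows "rat_adjoin (insert c S) = rat_adjoin (insert c T)"
proof -
  have "x \<in> rat_adjoin (insert c T)" if "x \<in> S" "rat_adjoin S = rat_adjoin T" for x S T
    using that rat_adjoin_mono[of T "insert c T"] rat_adjoin_incl[of x S] by blast
  then show ?thesis using assms by (intro rat_adjoin_eqI) (auto intro: rat_adjoin_incl)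
qed

lemma rat_adjoin_K4: "rat_adjoin K4 = rat_adjoin (insert \<i> Q2)"
  by (intro rat_adjoin_eqI) (auto intro: rat_adjoin_incl rt2_mem)

lemma rat_adjoin_K8: "rat_adjoin K8 = rat_adjoin (insert \<i> Q4)"
  by (intro rat_adjoin_eqI) (auto intro: rat_adjoin_incl rt2_mem rt4_mem)

lemma degree_K4_twist:
  fixes d :: int
  assumes d: "d \<noteq> 0" "squarefree d"
  shows "degree_over_rat (rat_adjoin (insert (csqrt (of_int d)) K4))
    (if d \<in> {1, - 1, 2, - 2} then 8 else 16)"
proof -
  have "degree_over_rat (rat_adjoin (insert \<i> Q2)) 8"
    using degree_insert_ii[OF real_tower(2) degree_Q2] by simp
  from degree_insert_csqrt_int[OF d _ _ _ this]
  have "degree_over_rat (rat_adjoin (insert (csqrt (of_int d)) (insert \<i> Q2)))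
      (if d \<in> {1, - 1, 2, - 2} then 8 else 2 * 8)" by blast
  moreover have "2 * 8 = (16 :: nat)" by simp
  ultimately show ?thesis unfolding rat_adjoin_insert_cong[OF rat_adjoin_K4] by (simp only:)
qed

lemma degree_K8_twist:
  fixes d :: int
  assumes d: "d \<noteq> 0" "squarefree d"
  shows "degree_over_rat (rat_adjoin (insert (csqrt (of_int d)) K8))
    (if d \<in> {1, - 1, 2, - 2} then 32 else 64)"
proof -
  have "degree_over_rat (rat_adjoin (insert \<i> Q4)) 32"
    using degree_insert_ii[OF real_tower(4) degree_Q4] by simp
  from degree_insert_csqrt_int[OF d _ _ _ this]
  have "degree_over_rat (rat_adjoin (insert (csqrt (of_int d)) (insert \<i> Q4)))
      (if d \<in> {1, - 1, 2, - 2} then 32 else 2 * 32)" by blast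
  moreover have "2 * 32 = (64 :: nat)" by simp
  ultimately show ?thesis unfolding rat_adjoin_insert_cong[OF rat_adjoin_K8] by (simp only:)
qed

lemma rat_adjoin_algebraic:
  "degree_over_rat (rat_adjoin S) n \<Longrightarrow> rat_adjoin S \<subseteq> algebraic_numbers"
  using finite_degree_imp_algebraic by (auto simp: algebraic_numbers_def)

lemma ec_scale_coords:
  assumes "c \<in> rat_adjoin S" "ec_coords P \<subseteq> rat_adjoin S"
  shows "ec_coords (ec_scale c P) \<subseteq> rat_adjoin S"
  using assms by (cases P) (auto intro!: rat_adjoin_mult rat_adjoin_power)

lemma coords_of_ec_scale:
  assumes "c \<noteq> 0" "c \<in> rat_adjoin S" "ec_coords (ec_scale c P) \<subseteq> rat_adjoin S"
  shows "ec_coords P \<subseteq> rat_adjoin S"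
proof (cases P)
  case (Affine x y)
  then have F: "c\<^sup>2 * x \<in> rat_adjoin S" "c ^ 3 * y \<in> rat_adjoin S" using assms(3) by simp_all
  have "c\<^sup>2 * x / c\<^sup>2 \<in> rat_adjoin S" "c ^ 3 * y / c ^ 3 \<in> rat_adjoin S"
    by (intro rat_adjoin_divide rat_adjoin_power assms(2) F)+
  then show ?thesis using Affine assms(1) by simp
qed simp

text \<open>
  The point \<open>(1, 2)\<close> is carried to \<open>(d, 2 d \<surd>d)\<close>, so the torsion field of the twist
  contains \<open>\<surd>d\<close> as soon as this point is among the torsion points.
\<close>

lemma torsion_field_twist:
  fixes d :: int
  assumes d: "d \<noteq> 0"
    and coords: "\<And>P. P \<in> E_torsion n \<Longrightarrow> ec_coords P \<subseteq> rat_adjoin K"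
    and gen: "\<And>S. (\<And>P. P \<in> E_torsion n \<Longrightarrow> ec_coords P \<subseteq> rat_adjoin S) \<Longrightarrow> K \<subseteq> rat_adjoin S"
    and pt: "Affine 1 2 \<in> E_torsion n"
    and deg: "degree_over_rat (rat_adjoin (insert (csqrt (of_int d)) K)) m"
  shows "torsion_field (E_a d) (E_b d) n = rat_adjoin (insert (csqrt (of_int d)) K)"
proof -
  define c where "c = csqrt (of_int d)"
  have c: "c \<noteq> 0" using d by (simp add: c_def)
  define U where "U = (\<Union>P \<in> E_torsion n. ec_coords (ec_scale c P))"
  have sub: "ec_coords (ec_scale c P) \<subseteq> rat_adjoin (insert c K)" if "P \<in> E_torsion n" for P
    using coords[OF that] rat_adjoin_mono[of K "insert c K"]
    by (intro ec_scale_coords) (auto intro: rat_adjoin_incl)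
  have "torsion_field (E_a d) (E_b d) n = rat_adjoin U"
    unfolding U_def c_def
    using sub rat_adjoin_algebraic[OF deg] by (intro torsion_field_eq_scale[OF d]) (auto simp: c_def)
  moreover have "rat_adjoin U = rat_adjoin (insert c K)"
  proof (rule rat_adjoin_eqI)
    show "U \<subseteq> rat_adjoin (insert c K)" using sub by (auto simp: U_def)
    have U: "ec_coords (ec_scale c P) \<subseteq> rat_adjoin U" if "P \<in> E_torsion n" for P
      using that by (auto simp: U_def intro: rat_adjoin_incl)
    have "c\<^sup>2 * 1 \<in> rat_adjoin U" "c ^ 3 * 2 \<in> rat_adjoin U" using U[OF pt] by simp_all
    then have "c ^ 3 * 2 / (c\<^sup>2 * 1) / 2 \<in> rat_adjoin U"
      by (intro rat_adjoin_divide rat_adjoin_numeral)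
    also have "c ^ 3 * 2 / (c\<^sup>2 * 1) / 2 = c" using c by (simp add: power2_eq_square power3_eq_cube)
    finally have cU: "c \<in> rat_adjoin U" .
    have "K \<subseteq> rat_adjoin U"
      by (rule gen) (rule coords_of_ec_scale[OF c cU U])
    then show "insert c K \<subseteq> rat_adjoin U" using cU by simp
  qed
  ultimately show ?thesis by (simp add: c_def)
qed

lemma torsion_field_2:
  fixes d :: int
  assumes d: "d \<noteq> 0"
  shows "torsion_field (E_a d) (E_b d) 2 = rat_adjoin {rt2}"
proof -
  define c where "c = csqrt (of_int d)"
  have c2: "c\<^sup>2 = of_int d" by (simp add: c_def)
  define U where "U = (\<Union>P \<in> E_torsion 2. ec_coords (ec_scale c P))"
  have U: "U = {of_int d * 2, of_int d * e2, of_int d * e3, 0}"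
    unfolding U_def E_torsion_2 by (auto simp: c2)
  have s: "rt2 \<in> rat_adjoin {rt2}" by (simp add: rat_adjoin_incl)
  have sub: "U \<subseteq> rat_adjoin {rt2}"
    unfolding U using root_mem[OF s] by (auto intro!: rat_adjoin_closed)
  have "torsion_field (E_a d) (E_b d) 2 = rat_adjoin U"
    unfolding U_def c_def
    using sub rat_adjoin_algebraic[OF degree_Q1]
    by (intro torsion_field_eq_scale[OF d]) (auto simp: U_def c_def)
  moreover have "rat_adjoin U = rat_adjoin {rt2}"
  proof (rule rat_adjoin_eqI[OF sub])
    have "of_int d * e2 \<in> rat_adjoin U" by (rule rat_adjoin_incl) (simp add: U)
    then have "of_int d * e2 / of_int d \<in> rat_adjoin U"
      by (intro rat_adjoin_divide rat_adjoin_of_int)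
    then have "e2 \<in> rat_adjoin U" using d by simp
    then show "{rt2} \<subseteq> rat_adjoin U" using root_mem_rt2 by simp
  qed
  ultimately show ?thesis by simp
qed

lemma torsion_field_4:
  fixes d :: int
  assumes "d \<noteq> 0" "squarefree d"
  shows "torsion_field (E_a d) (E_b d) 4 = rat_adjoin (insert (csqrt (of_int d)) K4)"
proof (rule torsion_field_twist[OF assms(1) _ _ _ degree_K4_twist[OF assms]])
  show "ec_coords P \<subseteq> rat_adjoin K4" if "P \<in> E_torsion 4" for P
    using that by (intro E_torsion_4_coords) (auto intro: rat_adjoin_incl)
  show "K4 \<subseteq> rat_adjoin S" if "\<And>P. P \<in> E_torsion 4 \<Longrightarrow> ec_coords P \<subseteq> rat_adjoin S" for S
    using E_torsion_4_generates[OF that] by simp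
qed (rule point_1_2)

lemma torsion_field_8:
  fixes d :: int
  assumes "d \<noteq> 0" "squarefree d"
  shows "torsion_field (E_a d) (E_b d) 8 = rat_adjoin (insert (csqrt (of_int d)) K8)"
proof (rule torsion_field_twist[OF assms(1) _ _ _ degree_K8_twist[OF assms]])
  show "ec_coords P \<subseteq> rat_adjoin K8" if "P \<in> E_torsion 8" for P
    using that by (intro E_torsion_8_coords) (auto intro: rat_adjoin_incl)
  show "K8 \<subseteq> rat_adjoin S" if "\<And>P. P \<in> E_torsion 8 \<Longrightarrow> ec_coords P \<subseteq> rat_adjoin S" for S
    using E_torsion_8_generates[OF that] by simp
  show "Affine 1 2 \<in> E_torsion 8" using point_1_2 E_torsion_4_subset_8 by blast
qed

theorem proposition3p10:
  fixes d :: int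
  assumes "d \<noteq> 0" and "squarefree d"
  shows "torsion_field (E_a d) (E_b d) 2 = rat_adjoin {csqrt 2} \<and>
    (\<forall>\<alpha>. f4 \<alpha> = 0 \<longrightarrow>
       torsion_field (E_a d) (E_b d) 4 = rat_adjoin {\<alpha>, csqrt (of_int d)}) \<and>
    (\<forall>\<beta>. f8 \<beta> = 0 \<longrightarrow>
       torsion_field (E_a d) (E_b d) 8 = rat_adjoin {\<beta>, csqrt (of_int d)}) \<and>
    degree_over_rat (torsion_field (E_a d) (E_b d) 2) 2 \<and>
    (d \<in> {1, -1, 2, -2} \<longrightarrow>
       degree_over_rat (torsion_field (E_a d) (E_b d) 4) 8 \<and>
       degree_over_rat (torsion_field (E_a d) (E_b d) 8) 32) \<and>
    (d \<notin> {1, -1, 2, -2} \<longrightarrow>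
       degree_over_rat (torsion_field (E_a d) (E_b d) 4) 16 \<and>
       degree_over_rat (torsion_field (E_a d) (E_b d) 8) 64)"
proof (intro conjI allI impI)
  show "torsion_field (E_a d) (E_b d) 2 = rat_adjoin {csqrt 2}"
    unfolding torsion_field_2[OF assms(1)] rt2_eq_csqrt ..
  show "degree_over_rat (torsion_field (E_a d) (E_b d) 2) 2"
    unfolding torsion_field_2[OF assms(1)] by (rule degree_Q1)
  show "torsion_field (E_a d) (E_b d) 4 = rat_adjoin {\<alpha>, csqrt (of_int d)}" if "f4 \<alpha> = 0" for \<alpha>
    using rat_adjoin_insert_cong[OF f4_root_field[OF that], of "csqrt (of_int d)"]
      torsion_field_4[OF assms] by (simp add: insert_commute)
  show "torsion_field (E_a d) (E_b d) 8 = rat_adjoin {\<beta>, csqrt (of_int d)}" if "f8 \<beta> = 0" for \<beta>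
    using rat_adjoin_insert_cong[OF f8_root_field[OF that], of "csqrt (of_int d)"]
      torsion_field_8[OF assms] by (simp add: insert_commute)
next
  assume d: "d \<in> {1, -1, 2, -2}"
  show "degree_over_rat (torsion_field (E_a d) (E_b d) 4) 8"
    using degree_K4_twist[OF assms] d unfolding torsion_field_4[OF assms] by (simp only: if_True)
  show "degree_over_rat (torsion_field (E_a d) (E_b d) 8) 32"
    using degree_K8_twist[OF assms] d unfolding torsion_field_8[OF assms] by (simp only: if_True)
next
  assume d: "d \<notin> {1, -1, 2, -2}"
  show "degree_over_rat (torsion_field (E_a d) (E_b d) 4) 16"
    using degree_K4_twist[OF assms] d unfolding torsion_field_4[OF assms] by (simp only: if_False)
  show "degree_over_rat (torsion_field (E_a d) (E_b d) 8) 64"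
    using degree_K8_twist[OF assms] d unfolding torsion_field_8[OF assms] by (simp only: if_False)
qed

end
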